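(* Suppose the log-normalizer $f(\theta)$ of the steep exponential family and the model parameter set $M$ are definable. Suppose $M\subset G$ is closed and bounded and $D$ has the structure $$D=\{\theta\in G:\ \mathbb E_\theta[t_1(x)]=\hat y\}.$$ Then the $em$-algorithm $\theta'^+\in\overrightarrow{P}_D\circ\overleftarrow{P}_M(\theta')$ converges, i.e. every sequence $(\theta'_k)$ in $D$ with $\theta'_{k+1}\in\overrightarrow{P}_D(\theta_k)$, $\theta_k\in\overleftarrow{P}_M(\theta'_k)$ converges.
   Context: An exponential family of densities with respect to a base measure $dx$ on a space $X$ is $p_\theta(x)=\exp(\langle\theta,t(x)\rangle-f(\theta)+k(x))$, with natural parameter $\theta\in\mathbb R^n$, sufficient statistic $t(x)$, carrier density $\exp k(x)$ and log-normalizer $f(\theta)=\log\int_X\exp\{\langle\theta,t(x)\rangle+k(x)\}\,dx$. It is called steep if $f$ is a convex function of Legendre type (in Rockafellar's sense). $G:=\mathrm{int}(\mathrm{dom}f)$; it is assumed that $f$ is of class $C^2$ on $G$ with $\nabla^2f(\theta)\succ0$ for all $\theta\in G$. $\mathbb E_\theta$ denotes expectation with respect to $p_\theta\,dx$; one has $\mathbb E_\theta[t(x)]=\nabla f(\theta)$. The sufficient statistic splits as $t(x)=(t_1(x),t_2(x))$ with observed part $y=t_1(x)$ and hidden part $z=t_2(x)$; $\hat y$ is the available sample (a fixed vector), and the data parameter set $D$ is assumed nonempty. $M\subset G$ is the nonempty set of model parameters. Bregman distance: $D_f(x,y)=f(x)-f(y)-\langle\nabla f(y),x-y\rangle$ for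 $y\in G$; one has $K(p_{\theta'}||p_\theta)=D_f(\theta,\theta')$ with $K$ the Kullback-Leibler divergence. $\overrightarrow{P}_D(\theta)=\mathrm{argmin}\{D_f(\theta,\theta'):\theta'\in D\}$ and $\overleftarrow{P}_M(\theta')=\mathrm{argmin}\{D_f(\theta,\theta'):\theta\in M\}$ (set-valued). $em$-algorithm: $e$-step: given $\theta\in M$, choose $\theta'\in\overrightarrow{P}_D(\theta)$; $m$-step: given $\theta'\in D$, choose $\theta\in\overleftarrow{P}_M(\theta')$; repeat. "Definable" means definable in a common o-minimal structure on the real field. *)

theory Defs
  imports "HOL-Analysis.Analysis"
begin

section \<open>O-minimal structures on the real field\<close>

text \<open>
  Points of the n-th Cartesian power of the reals are lists of length n, and S n is the collection
  of definable subsets of that power.  The axioms are those of van den Dries.  Since the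
  one-dimensional definable sets are exactly the finite unions of intervals and points, all real
  constants are definable, i.e. definability is understood with parameters.
\<close>

locale o_minimal_structure =
  fixes S :: "nat \<Rightarrow> real list set set"
  assumes subset: "A \<in> S n \<Longrightarrow> A \<subseteq> {xs. length xs = n}"
    and empty: "{} \<in> S n"
    and union: "A \<in> S n \<Longrightarrow> B \<in> S n \<Longrightarrow> A \<union> B \<in> S n"
    and compl: "A \<in> S n \<Longrightarrow> {xs. length xs = n} - A \<in> S n"
    and cylinder_left: "A \<in> S n \<Longrightarrow> {x # xs |x xs. xs \<in> A} \<in> S (Suc n)"
    and cylinder_right: "A \<in> S n \<Longrightarrow> {xs @ [x] |xs x. xs \<in> A} \<in> S (Suc n)"
    and diagonal: "i < n \<Longrightarrow> j < n \<Longrightarrow> {xs. length xs = n \<and> xs ! i = xs ! j} \<in> S n"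
    and projection: "A \<in> S (Suc n) \<Longrightarrow> butlast ` A \<in> S n"
    and less: "{[x, y] |x y. x < y} \<in> S 2"
    and add: "{[x, y, x + y] |x y. True} \<in> S 3"
    and mult: "{[x, y, x * y] |x y. True} \<in> S 3"
    and o_minimal: "S 1 = {(\<lambda>x. [x]) ` (\<Union>F) |F. finite F \<and> (\<forall>I\<in>F. is_interval I)}"

text \<open>
  A Euclidean space is identified with a power of the reals by listing its standard basis.  As a
  structure is closed under permutation of coordinates, the order of the list is immaterial.
\<close>

definition definable_set ::
    "(nat \<Rightarrow> real list set set) \<Rightarrow> 'a::euclidean_space set \<Rightarrow> bool" where
  "definable_set S A \<longleftrightarrow>
     (\<exists>bs. distinct bs \<and> set bs = Basis \<and> (\<lambda>x. map (\<lambda>b. x \<bullet> b) bs) ` A \<in> S DIM('a))"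

text \<open>
  An extended-real-valued function is definable if the graph of its finite part is.
\<close>

definition definable_fun ::
    "(nat \<Rightarrow> real list set set) \<Rightarrow> ('a::euclidean_space \<Rightarrow> ereal) \<Rightarrow> bool" where
  "definable_fun S f \<longleftrightarrow> definable_set S {(x, r). f x = ereal r}"

section \<open>Convex functions of Legendre type and Bregman distances\<close>

definition edom :: "('a \<Rightarrow> ereal) \<Rightarrow> 'a set" where
  "edom f = {x. f x < \<infinity>}"

definition proper_convex :: "('a::real_vector \<Rightarrow> ereal) \<Rightarrow> bool" where
  "proper_convex f \<longleftrightarrow>
     (\<forall>x. f x \<noteq> -\<infinity>) \<and> edom f \<noteq> {} \<and> convex {(x, r). f x \<le> ereal r}"

text \<open>
  Meaningful at interior points of the effective domain at which f is finite and differentiable.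
\<close>

definition grad :: "('a::real_inner \<Rightarrow> ereal) \<Rightarrow> 'a \<Rightarrow> 'a" where
  "grad f x = (THE d. GDERIV (\<lambda>z. real_of_ereal (f z)) x :> d)"

text \<open>
  Rockafellar, Convex Analysis, Section 26: with C the interior of the effective domain, the pair
  (C, f) is of Legendre type.
\<close>

definition legendre_type :: "('a::euclidean_space \<Rightarrow> ereal) \<Rightarrow> bool" where
  "legendre_type f \<longleftrightarrow> (let C = interior (edom f) in
     proper_convex f \<and> C \<noteq> {} \<and>
     (\<forall>x\<in>C. \<forall>y\<in>C. \<forall>u::real. x \<noteq> y \<and> 0 < u \<and> u < 1 \<longrightarrow>
        f ((1 - u) *\<^sub>R x + u *\<^sub>R y) < ereal (1 - u) * f x + ereal u * f y) \<and>
     (\<forall>x\<in>C. (\<lambda>z. real_of_ereal (f z)) differentiable (at x)) \<and>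
     (\<forall>s x. (\<forall>i::nat. s i \<in> C) \<and> x \<in> frontier C \<and> s \<longlonglongrightarrow> x \<longrightarrow>
        filterlim (\<lambda>i. norm (grad f (s i))) at_top sequentially))"

text \<open>
  Class C2 on an open set, with positive definite Hessian H.
\<close>

definition C2_pos_def_on :: "('a::euclidean_space \<Rightarrow> ereal) \<Rightarrow> 'a set \<Rightarrow> bool" where
  "C2_pos_def_on f G \<longleftrightarrow>
     (\<exists>H :: 'a \<Rightarrow> 'a \<Rightarrow>\<^sub>L 'a. continuous_on G H \<and>
       (\<forall>x\<in>G. GDERIV (\<lambda>z. real_of_ereal (f z)) x :> grad f x \<and>
              (grad f has_derivative blinfun_apply (H x)) (at x) \<and>
              (\<forall>v. v \<noteq> 0 \<longrightarrow> 0 < v \<bullet> blinfun_apply (H x) v)))"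

text \<open>
  The second argument is meant to lie in the interior of the effective domain.
\<close>

definition bregman :: "('a::real_inner \<Rightarrow> ereal) \<Rightarrow> 'a \<Rightarrow> 'a \<Rightarrow> ereal" where
  "bregman f x y = f x - f y - ereal (grad f y \<bullet> (x - y))"

definition right_proj ::
    "('a::real_inner \<Rightarrow> ereal) \<Rightarrow> 'a set \<Rightarrow> 'a \<Rightarrow> 'a set" where
  "right_proj f D \<theta> = {\<theta>'. is_arg_min (\<lambda>y. bregman f \<theta> y) (\<lambda>y. y \<in> D) \<theta>'}"

definition left_proj ::
    "('a::real_inner \<Rightarrow> ereal) \<Rightarrow> 'a set \<Rightarrow> 'a \<Rightarrow> 'a set" where
  "left_proj f M \<theta>' = {\<theta>. is_arg_min (\<lambda>x. bregman f x \<theta>') (\<lambda>x. x \<in> M) \<theta>}"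

section \<open>Exponential families\<close>

text \<open>
  Base measure \<mu>, sufficient statistic t, log-carrier density k.  The normalizing integral is taken
  in the extended non-negative reals, so the log-normalizer is defined on the whole space.
\<close>

definition partition_fun ::
    "'x measure \<Rightarrow> ('x \<Rightarrow> 'a::euclidean_space) \<Rightarrow> ('x \<Rightarrow> real) \<Rightarrow> 'a \<Rightarrow> ennreal" where
  "partition_fun \<mu> t k \<theta> = (\<integral>\<^sup>+ x. ennreal (exp (\<theta> \<bullet> t x + k x)) \<partial>\<mu>)"

definition log_normalizer ::
    "'x measure \<Rightarrow> ('x \<Rightarrow> 'a::euclidean_space) \<Rightarrow> ('x \<Rightarrow> real) \<Rightarrow> 'a \<Rightarrow> ereal" where
  "log_normalizer \<mu> t k \<theta> =
     (if partition_fun \<mu> t k \<theta> = \<infinity> then \<infinity>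
      else if partition_fun \<mu> t k \<theta> = 0 then -\<infinity>
      else ereal (ln (enn2real (partition_fun \<mu> t k \<theta>))))"

definition exp_density ::
    "'x measure \<Rightarrow> ('x \<Rightarrow> 'a::euclidean_space) \<Rightarrow> ('x \<Rightarrow> real) \<Rightarrow> 'a \<Rightarrow> 'x \<Rightarrow> real" where
  "exp_density \<mu> t k \<theta> x =
     exp (\<theta> \<bullet> t x - real_of_ereal (log_normalizer \<mu> t k \<theta>) + k x)"

definition exp_expectation ::
    "'x measure \<Rightarrow> ('x \<Rightarrow> 'a::euclidean_space) \<Rightarrow> ('x \<Rightarrow> real) \<Rightarrow> 'a \<Rightarrow>
     ('x \<Rightarrow> 'b::euclidean_space) \<Rightarrow> 'b" where
  "exp_expectation \<mu> t k \<theta> h =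
     (LINT x | density \<mu> (\<lambda>x. ennreal (exp_density \<mu> t k \<theta> x)). h x)"

end

theory Submission
  imports Defs
begin

text \<open>
  Write \<open>\<phi>(\<theta>) = f(\<theta>) - \<langle>y_hat, \<theta>\<^sub>1\<rangle>\<close>. As \<open>E[t\<^sub>1]\<close> is the first component of
  \<open>\<nabla>f\<close>, the set \<open>D\<close> consists of the points that minimize \<open>\<phi>\<close> on their slice
  \<open>{\<theta>\<^sub>2 = const}\<close>; hence it is definable without any reference to gradients. The e-step keeps
  the component \<open>\<theta>\<^sub>2\<close>, and Pythagoras' identity
  \<open>D\<^sub>f(\<theta>, p) = (\<phi>(\<theta>) - \<phi>(\<theta>')) + D\<^sub>f(\<theta>', p)\<close> for \<open>\<theta>', p \<in> D\<close>,
  \<open>\<theta>\<^sub>2 = \<theta>'\<^sub>2\<close>, turns the em-algorithm into a Bregman proximal point method for the definable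
  function \<open>F(\<theta>, \<theta>') = \<phi>(\<theta>) - \<phi>(\<theta>')\<close> on the pairs in \<open>M \<times> D\<close> with
  \<open>\<theta>\<^sub>2 = \<theta>'\<^sub>2\<close>. Steepness makes the sublevel sets of \<open>F\<close> compact.

  Convergence of such a method is proved in the spirit of Kurdyka's talweg argument, but without a
  desingularizing function. On each level set of \<open>F\<close> choose definably a point of least slope. The
  resulting curve is bounded and its coordinates are monotone close to the limit value, so its
  variation along the values of the iteration is summable. Comparing iterate and curve at equal values
  gives \<open>\<delta>\<^sub>k\<^sub>+\<^sub>1 \<le> \<delta>\<^sub>k / 2 + a \<Delta>\<^sub>k\<close> for the step lengths \<open>\<delta>\<^sub>k\<close> and the
  increments \<open>\<Delta>\<^sub>k\<close> of the curve, whence the step lengths are summable.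
\<close>

section \<open>Calculus of definable sets\<close>

context o_minimal_structure
begin

lemma full: "{xs. length xs = n} \<in> S n"
  using compl[OF empty, of n] by simp

lemma inter: assumes "A \<in> S n" "B \<in> S n" shows "A \<inter> B \<in> S n"
proof -
  have "A \<inter> B = {xs. length xs = n} -
      (({xs. length xs = n} - A) \<union> ({xs. length xs = n} - B))"
    using subset[OF assms(1)] by auto
  then show ?thesis
    using compl[OF union[OF compl[OF assms(1)] compl[OF assms(2)]]] by simp
qed

lemma inter_finite:
  assumes "finite I" "\<And>i. i \<in> I \<Longrightarrow> {xs. length xs = n \<and> P i xs} \<in> S n"
  shows "{xs. length xs = n \<and> (\<forall>i\<in>I. P i xs)} \<in> S n"
  using assms
proof (induction I rule: finite_induct)
  case empty
  then show ?case using full by simp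
next
  case (insert i I)
  have "{xs. length xs = n \<and> (\<forall>i\<in>insert i I. P i xs)}
      = {xs. length xs = n \<and> P i xs} \<inter> {xs. length xs = n \<and> (\<forall>i\<in>I. P i xs)}"
    by auto
  then show ?case using insert inter by simp
qed

lemma cylinder_left_append:
  "A \<in> S m \<Longrightarrow> {xs @ ys |xs ys. length xs = n \<and> ys \<in> A} \<in> S (n + m)"
proof (induction n)
  case 0
  then show ?case by simp
next
  case (Suc n)
  have "{xs @ ys |xs ys. length xs = Suc n \<and> ys \<in> A}
     = {x # zs |x zs. zs \<in> {xs @ ys |xs ys. length xs = n \<and> ys \<in> A}}"
    by (auto simp: length_Suc_conv) (metis append_Cons)+
  then show ?case using cylinder_left[OF Suc.IH[OF Suc.prems]] by simp
qed

lemma projection_take: "A \<in> S (n + m) \<Longrightarrow> take n ` A \<in> S n"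
proof (induction m arbitrary: A)
  case 0
  have "take n xs = xs" if "xs \<in> A" for xs using subset[OF 0] that by auto
  then show ?case using 0 by simp
next
  case (Suc m)
  have "take n xs = take n (butlast xs)" if "xs \<in> A" for xs
    using subset[OF Suc.prems] that by (auto simp: butlast_conv_take)
  then have "take n ` A = take n ` butlast ` A"
    by (simp add: image_image)
  then show ?case using Suc.IH[of "butlast ` A"] projection[of A "n + m"] Suc.prems by simp
qed

text \<open>Substitution of variables; \<open>js\<close> may permute, repeat or omit coordinates. A
  point of \<open>A\<close> is appended to \<open>xs\<close>, diagonals force its entries to be the
  selected entries of \<open>xs\<close>, and the appended block is projected away.\<close>

lemma reindex:
  assumes A: "A \<in> S m" and js: "length js = m" "\<And>i. i \<in> set js \<Longrightarrow> i < n"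
  shows "{xs. length xs = n \<and> map ((!) xs) js \<in> A} \<in> S n"
proof -
  let ?E = "{zs. length zs = n + m \<and> (\<forall>j\<in>{..<m}. zs ! (n + j) = zs ! (js ! j))}"
  let ?C = "{xs @ ys |xs ys. length xs = n \<and> ys \<in> A}"
  have E: "?E \<in> S (n + m)"
    by (intro inter_finite diagonal) (use js in \<open>auto intro: trans_less_add1\<close>)
  have "{xs. length xs = n \<and> map ((!) xs) js \<in> A} = take n ` (?C \<inter> ?E)"
  proof (intro equalityI subsetI)
    fix xs assume xs: "xs \<in> {xs. length xs = n \<and> map ((!) xs) js \<in> A}"
    have "xs @ map ((!) xs) js \<in> ?C \<inter> ?E"
      using xs js by (auto simp: nth_append)
    moreover have "xs = take n (xs @ map ((!) xs) js)" using xs by simp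
    ultimately show "xs \<in> take n ` (?C \<inter> ?E)" by blast
  next
    fix xs assume "xs \<in> take n ` (?C \<inter> ?E)"
    then obtain us ys where u: "xs = us" "length us = n" "ys \<in> A" "us @ ys \<in> ?E"
      by auto
    have ly: "length ys = m" using subset[OF A] u by auto
    have "ys ! j = us ! (js ! j)" if "j < m" for j
    proof -
      have "(us @ ys) ! (n + j) = (us @ ys) ! (js ! j)" using u that by simp
      then show ?thesis using u(2) js that by (simp add: nth_append)
    qed
    then have "map ((!) xs) js = ys"
      using u ly js by (auto intro!: nth_equalityI)
    then show "xs \<in> {xs. length xs = n \<and> map ((!) xs) js \<in> A}" using u by simp
  qed
  then show ?thesis using projection_take[OF inter[OF cylinder_left_append[OF A] E]] by (simp only:)
qed

end

text \<open>Translates a condition on the coordinates \<open>cs\<close> of a vector into one on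
  positions in a coordinate list, the form that \<open>reindex\<close> handles: \<open>js\<close>
  records where the members of \<open>cs\<close> occur in \<open>bs\<close>.\<close>

lemma coordinates_image:
  fixes bs cs :: "'a::euclidean_space list"
  assumes bs: "distinct bs" "set bs = Basis" and cs: "set cs \<subseteq> Basis"
  shows "\<exists>js. length js = length cs \<and> (\<forall>i\<in>set js. i < length bs) \<and>
    (\<lambda>x. map (\<lambda>b. x \<bullet> b) bs) ` {x. map (\<lambda>b. x \<bullet> b) cs \<in> B}
      = {xs. length xs = length bs \<and> map ((!) xs) js \<in> B}"
proof -
  define pos where "pos b = (SOME i. i < length bs \<and> bs ! i = b)" for b
  have pos: "pos b < length bs \<and> bs ! pos b = b" if "b \<in> Basis" for b
    unfolding pos_def by (rule someI_ex) (use that bs in \<open>metis in_set_conv_nth\<close>)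
  have map_eq: "map ((!) (map (\<lambda>b. x \<bullet> b) bs)) (map pos cs) = map (\<lambda>b. x \<bullet> b) cs" for x
    using pos cs by auto
  have surj: "xs \<in> (\<lambda>x. map (\<lambda>b. x \<bullet> b) bs) ` UNIV" if "length xs = length bs" for xs
  proof
    have "map (\<lambda>b. (\<Sum>c\<in>Basis. xs ! pos c *\<^sub>R c) \<bullet> b) bs = map (\<lambda>b. xs ! pos b) bs"
      using bs by (auto intro!: map_cong simp: inner_sum_left inner_Basis if_distrib sum.delta cong: if_cong)
    also have "\<dots> = xs"
    proof (rule nth_equalityI)
      fix i assume "i < length (map (\<lambda>b. xs ! pos b) bs)"
      then have i: "i < length bs" by simp
      then have "pos (bs ! i) = i"
        using pos[of "bs ! i"] bs by (metis nth_eq_iff_index_eq nth_mem)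
      then show "map (\<lambda>b. xs ! pos b) bs ! i = xs ! i" using i by simp
    qed (use that in simp)
    finally show "xs = map (\<lambda>b. (\<Sum>c\<in>Basis. xs ! pos c *\<^sub>R c) \<bullet> b) bs" by simp
  qed simp
  have "(\<lambda>x. map (\<lambda>b. x \<bullet> b) bs) ` {x. map (\<lambda>b. x \<bullet> b) cs \<in> B}
      = {xs. length xs = length bs \<and> map ((!) xs) (map pos cs) \<in> B}"
  proof (intro equalityI subsetI)
    fix xs assume "xs \<in> {xs. length xs = length bs \<and> map ((!) xs) (map pos cs) \<in> B}"
    then have xs: "length xs = length bs" "map ((!) xs) (map pos cs) \<in> B" by auto
    obtain x where x: "xs = map (\<lambda>b. x \<bullet> b) bs" using surj[OF xs(1)] by auto
    have "map (\<lambda>b. x \<bullet> b) cs \<in> B" using xs(2) unfolding x map_eq .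
    then show "xs \<in> (\<lambda>x. map (\<lambda>b. x \<bullet> b) bs) ` {x. map (\<lambda>b. x \<bullet> b) cs \<in> B}"
      using x by blast
  next
    fix xs assume "xs \<in> (\<lambda>x. map (\<lambda>b. x \<bullet> b) bs) ` {x. map (\<lambda>b. x \<bullet> b) cs \<in> B}"
    then obtain x where x: "xs = map (\<lambda>b. x \<bullet> b) bs" "map (\<lambda>b. x \<bullet> b) cs \<in> B" by blast
    have "map ((!) xs) (map pos cs) \<in> B" using x(2) unfolding x(1) map_eq .
    then show "xs \<in> {xs. length xs = length bs \<and> map ((!) xs) (map pos cs) \<in> B}"
      using x(1) by simp
  qed
  then show ?thesis using pos cs by (intro exI[of _ "map pos cs"]) auto
qed

text \<open>Such maps select, permute or duplicate variables. Preimages under them reduce to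
  \<open>reindex\<close> alone; preimages under general definable maps are later obtained from these
  by projecting along the graph.\<close>

definition coordinate_map :: "('a::euclidean_space \<Rightarrow> 'b::euclidean_space) \<Rightarrow> bool" where
  "coordinate_map \<pi> \<longleftrightarrow> (\<forall>b\<in>Basis. \<exists>c\<in>Basis. \<forall>x. \<pi> x \<bullet> b = x \<bullet> c)"

lemma coordinate_map_id: "coordinate_map (\<lambda>x. x)"
  by (auto simp: coordinate_map_def)

lemma coordinate_map_fst:
  fixes g :: "'a::euclidean_space \<Rightarrow> 'b::euclidean_space \<times> 'c::euclidean_space"
  assumes "coordinate_map g" shows "coordinate_map (\<lambda>x. fst (g x))"
  unfolding coordinate_map_def
proof
  fix b :: 'b assume "b \<in> Basis"
  then have "(b, 0) \<in> (Basis :: ('b \<times> 'c) set)" by (simp add: Basis_prod_def)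
  then obtain c where "c \<in> Basis" "\<forall>x. g x \<bullet> (b, 0) = x \<bullet> c"
    using assms unfolding coordinate_map_def by blast
  then show "\<exists>c\<in>Basis. \<forall>x. fst (g x) \<bullet> b = x \<bullet> c"
    by (intro bexI[of _ c]) (auto simp: inner_prod_def)
qed

lemma coordinate_map_snd:
  fixes g :: "'a::euclidean_space \<Rightarrow> 'b::euclidean_space \<times> 'c::euclidean_space"
  assumes "coordinate_map g" shows "coordinate_map (\<lambda>x. snd (g x))"
  unfolding coordinate_map_def
proof
  fix b :: 'c assume "b \<in> Basis"
  then have "(0, b) \<in> (Basis :: ('b \<times> 'c) set)" by (simp add: Basis_prod_def)
  then obtain c where "c \<in> Basis" "\<forall>x. g x \<bullet> (0, b) = x \<bullet> c"
    using assms unfolding coordinate_map_def by blast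
  then show "\<exists>c\<in>Basis. \<forall>x. snd (g x) \<bullet> b = x \<bullet> c"
    by (intro bexI[of _ c]) (auto simp: inner_prod_def)
qed

lemma coordinate_map_inner:
  "coordinate_map g \<Longrightarrow> b \<in> Basis \<Longrightarrow> coordinate_map (\<lambda>x. g x \<bullet> b)"
  by (auto simp: coordinate_map_def)

lemma coordinate_map_Pair:
  "coordinate_map g \<Longrightarrow> coordinate_map h \<Longrightarrow> coordinate_map (\<lambda>x. (g x, h x))"
  by (auto simp: coordinate_map_def Basis_prod_def)

lemmas coordinate_map_intros = coordinate_map_id coordinate_map_fst coordinate_map_snd
  coordinate_map_inner coordinate_map_Pair

lemma ex_Basis_list: "\<exists>bs :: 'a::euclidean_space list. distinct bs \<and> set bs = Basis"
  using finite_distinct_list[OF finite_Basis] by metis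

lemma length_Basis_list:
  "distinct bs \<Longrightarrow> set bs = (Basis :: 'a::euclidean_space set) \<Longrightarrow> length bs = DIM('a)"
  by (metis distinct_card)

section \<open>First-order closure properties of definable subsets of Euclidean spaces\<close>

context o_minimal_structure
begin

abbreviation definable where "definable A \<equiv> definable_set S A"

lemma image_coordinates_preimage:
  fixes bs cs :: "'a::euclidean_space list"
  assumes "B \<in> S (length cs)" "set cs \<subseteq> Basis" "distinct bs" "set bs = Basis"
  shows "(\<lambda>x. map (\<lambda>b. x \<bullet> b) bs) ` {x. map (\<lambda>b. x \<bullet> b) cs \<in> B} \<in> S DIM('a)"
proof -
  obtain js where js: "length js = length cs" "\<forall>i\<in>set js. i < length bs"
    and eq: "(\<lambda>x. map (\<lambda>b. x \<bullet> b) bs) ` {x. map (\<lambda>b. x \<bullet> b) cs \<in> B}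
      = {xs. length xs = length bs \<and> map ((!) xs) js \<in> B}"
    using coordinates_image[OF assms(3,4,2)] by blast
  show ?thesis unfolding eq using reindex[OF assms(1) js(1), of "length bs"] js(2)
    length_Basis_list[OF assms(3,4)] by simp
qed

lemma definable_coordinates:
  fixes cs :: "'a::euclidean_space list"
  assumes "B \<in> S (length cs)" "set cs \<subseteq> Basis"
  shows "definable {x. map (\<lambda>b. x \<bullet> b) cs \<in> B}"
  using image_coordinates_preimage[OF assms] ex_Basis_list unfolding definable_set_def by blast

lemma definableE:
  fixes A :: "'a::euclidean_space set"
  assumes "definable A"
  obtains bs B where "set bs = Basis" "B \<in> S (length bs)" "A = {x. map (\<lambda>b. x \<bullet> b) bs \<in> B}"
proof -
  obtain bs where bs: "distinct bs" "set bs = Basis"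
    and B: "(\<lambda>x. map (\<lambda>b. x \<bullet> b) bs) ` A \<in> S DIM('a)"
    using assms unfolding definable_set_def by blast
  have inj: "inj (\<lambda>x. map (\<lambda>b. x \<bullet> b) bs)"
    by (auto simp: inj_def bs intro: euclidean_eqI)
  have "A = {x. map (\<lambda>b. x \<bullet> b) bs \<in> (\<lambda>x. map (\<lambda>b. x \<bullet> b) bs) ` A}"
    using inj by (auto dest: injD)
  then show ?thesis using that[OF bs(2) _] B length_Basis_list[OF bs] by metis
qed

text \<open>\<open>definable_set\<close> provides just one enumeration of the basis. Permuting
  coordinates gives every other one, so that sets presented with different enumerations can be
  combined.\<close>

lemma definable_image_coordinates:
  fixes A :: "'a::euclidean_space set"
  assumes "definable A" "distinct cs" "set cs = Basis"
  shows "(\<lambda>x. map (\<lambda>b. x \<bullet> b) cs) ` A \<in> S DIM('a)"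
proof -
  obtain bs B where "set bs = Basis" "B \<in> S (length bs)" "A = {x. map (\<lambda>b. x \<bullet> b) bs \<in> B}"
    using definableE[OF assms(1)] .
  then show ?thesis using image_coordinates_preimage[of B bs cs] assms by simp
qed

lemma definable_coordinate_vimage:
  fixes \<pi> :: "'a::euclidean_space \<Rightarrow> 'b::euclidean_space"
  assumes A: "definable A" and \<pi>: "coordinate_map \<pi>"
  shows "definable {x. \<pi> x \<in> A}"
proof -
  obtain bs B where bs: "set bs = Basis" "B \<in> S (length bs)" "A = {x. map (\<lambda>b. x \<bullet> b) bs \<in> B}"
    using definableE[OF A] .
  obtain \<beta> where \<beta>: "\<And>b. b \<in> Basis \<Longrightarrow> \<beta> b \<in> Basis \<and> (\<forall>x. \<pi> x \<bullet> b = x \<bullet> \<beta> b)"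
    using \<pi> unfolding coordinate_map_def by metis
  have "{x. \<pi> x \<in> A} = {x. map (\<lambda>b. x \<bullet> b) (map \<beta> bs) \<in> B}"
  proof -
    have "map (\<lambda>b. \<pi> x \<bullet> b) bs = map (\<lambda>b. x \<bullet> b) (map \<beta> bs)" for x
      using \<beta> bs(1) by simp
    then show ?thesis unfolding bs(3) by (simp only: mem_Collect_eq)
  qed
  moreover have "definable {x. map (\<lambda>b. x \<bullet> b) (map \<beta> bs) \<in> B}"
    by (rule definable_coordinates) (use \<beta> bs in auto)
  ultimately show ?thesis by metis
qed

lemma definable_ex:
  fixes P :: "'a::euclidean_space \<Rightarrow> 'b::euclidean_space \<Rightarrow> bool"
  assumes "definable {p. P (fst p) (snd p)}"
  shows "definable {x. \<exists>y. P x y}"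
proof -
  obtain xs :: "'a list" where xs: "distinct xs" "set xs = Basis" using ex_Basis_list by blast
  obtain bs :: "'b list" where bs: "distinct bs" "set bs = Basis" using ex_Basis_list by blast
  \<comment> \<open>The coordinates of the first factor come first, so that quantifying over the
    second factor amounts to cutting the list after \<open>DIM('a)\<close> entries.\<close>
  let ?cs = "map (\<lambda>a. (a, 0 :: 'b)) xs @ map (\<lambda>b. (0 :: 'a, b)) bs"
  have cs: "distinct ?cs" "set ?cs = Basis"
  proof -
    have "distinct (map (\<lambda>a. (a, 0 :: 'b)) xs)" "distinct (map (\<lambda>b. (0 :: 'a, b)) bs)"
      using xs bs by (simp_all add: distinct_map inj_on_def)
    moreover have "set (map (\<lambda>a. (a, 0 :: 'b)) xs) \<inter> set (map (\<lambda>b. (0 :: 'a, b)) bs) = {}"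
      using xs bs nonzero_Basis by fastforce
    ultimately show "distinct ?cs" by simp
    show "set ?cs = Basis" using xs bs by (simp add: Basis_prod_def)
  qed
  have "(\<lambda>x. map (\<lambda>b. x \<bullet> b) ?cs) ` {p. P (fst p) (snd p)} \<in> S (DIM('a) + DIM('b))"
    using definable_image_coordinates[OF assms cs] by simp
  from projection_take[OF this]
  have "take DIM('a) ` (\<lambda>x. map (\<lambda>b. x \<bullet> b) ?cs) ` {p. P (fst p) (snd p)} \<in> S DIM('a)" .
  moreover have "take DIM('a) ` (\<lambda>x. map (\<lambda>b. x \<bullet> b) ?cs) ` {p. P (fst p) (snd p)}
    = (\<lambda>x. map (\<lambda>b. x \<bullet> b) xs) ` {x. \<exists>y. P x y}"
  proof -
    have "take DIM('a) (map (\<lambda>b. x \<bullet> b) ?cs) = map (\<lambda>b. fst x \<bullet> b) xs" for x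
      using length_Basis_list[OF xs] by (simp add: comp_def inner_prod_def)
    moreover have "{x. \<exists>y. P x y} = fst ` {p. P (fst p) (snd p)}" by (auto simp: image_iff)
    ultimately show ?thesis by (simp add: image_image)
  qed
  ultimately show ?thesis unfolding definable_set_def using xs by auto
qed

lemma definable_not:
  fixes P :: "'a::euclidean_space \<Rightarrow> bool"
  assumes "definable {x. P x}" shows "definable {x. \<not> P x}"
proof -
  obtain bs B where bs: "set bs = Basis" "B \<in> S (length bs)"
    "{x. P x} = {x. map (\<lambda>b. x \<bullet> b) bs \<in> B}"
    using definableE[OF assms] .
  have "P x \<longleftrightarrow> map (\<lambda>b. x \<bullet> b) bs \<in> B" for x using bs(3) by blast
  then have "{x. \<not> P x} = {x. map (\<lambda>b. x \<bullet> b) bs \<in> {xs. length xs = length bs} - B}" by simp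
  moreover have "definable {x. map (\<lambda>b. x \<bullet> b) bs \<in> {xs. length xs = length bs} - B}"
    by (rule definable_coordinates) (use bs(1) compl[OF bs(2)] in auto)
  ultimately show ?thesis by simp
qed

lemma definable_conj:
  fixes P Q :: "'a::euclidean_space \<Rightarrow> bool"
  assumes "definable {x. P x}" "definable {x. Q x}" shows "definable {x. P x \<and> Q x}"
proof -
  obtain cs :: "'a list" where cs: "distinct cs" "set cs = Basis" using ex_Basis_list by blast
  let ?m = "\<lambda>x. map (\<lambda>b. x \<bullet> b) cs"
  have inj: "inj ?m" by (auto simp: inj_def cs intro: euclidean_eqI)
  have "?m ` {x. P x \<and> Q x} = ?m ` {x. P x} \<inter> ?m ` {x. Q x}"
    unfolding Collect_conj_eq by (rule image_Int[OF inj])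
  moreover have "?m ` {x. P x} \<inter> ?m ` {x. Q x} \<in> S DIM('a)"
    by (intro inter definable_image_coordinates assms cs)
  ultimately have "?m ` {x. P x \<and> Q x} \<in> S DIM('a)" by (simp only:)
  then show ?thesis using cs unfolding definable_set_def by blast
qed

lemma definable_disj:
  assumes "definable {x. P x}" "definable {x. Q x}" shows "definable {x. P x \<or> Q x}"
  using definable_not[OF definable_conj[OF definable_not[OF assms(1)] definable_not[OF assms(2)]]]
  by simp

lemma definable_imp:
  assumes "definable {x. P x}" "definable {x. Q x}" shows "definable {x. P x \<longrightarrow> Q x}"
  using definable_not[OF definable_conj[OF assms(1) definable_not[OF assms(2)]]]
  by simp

lemma definable_all:
  fixes P :: "'a::euclidean_space \<Rightarrow> 'b::euclidean_space \<Rightarrow> bool"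
  assumes "definable {p. P (fst p) (snd p)}"
  shows "definable {x. \<forall>y. P x y}"
  using definable_not[OF definable_ex[of "\<lambda>x y. \<not> P x y", OF definable_not[OF assms]]] by simp

lemma definable_Ball_finite:
  fixes P :: "'i \<Rightarrow> 'a::euclidean_space \<Rightarrow> bool"
  assumes "finite I" "\<And>i. i \<in> I \<Longrightarrow> definable {x. P i x}"
  shows "definable {x. \<forall>i\<in>I. P i x}"
  using assms
proof (induction I rule: finite_induct)
  case empty
  \<comment> \<open>The whole space is the preimage of the zero-dimensional power under the empty
    list of coordinates.\<close>
  have "definable {x::'a. map (\<lambda>b. x \<bullet> b) [] \<in> {xs. length xs = 0}}"
    by (rule definable_coordinates) (use full[of 0] in auto)
  then show ?case by simp
next
  case (insert i I)
  have "definable {x. P i x \<and> (\<forall>i\<in>I. P i x)}"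
    by (intro definable_conj insert.IH insert.prems) auto
  then show ?case by simp
qed

lemma definable_coordinate_eq:
  fixes b c :: "'a::euclidean_space"
  assumes "b \<in> Basis" "c \<in> Basis" shows "definable {x. x \<bullet> b = x \<bullet> c}"
proof -
  have "definable {x. map (\<lambda>b. x \<bullet> b) [b, c] \<in> {xs. length xs = 2 \<and> xs ! 0 = xs ! 1}}"
    by (rule definable_coordinates) (use assms diagonal[of 0 2 1] in \<open>auto simp: numeral_2_eq_2\<close>)
  then show ?thesis by simp
qed

section \<open>Definable maps and their arithmetic\<close>

definition definable_map :: "('a::euclidean_space \<Rightarrow> 'b::euclidean_space) \<Rightarrow> bool" where
  "definable_map g \<longleftrightarrow> definable {p. snd p = g (fst p)}"

lemma coordinate_map_definable:
  fixes \<pi> :: "'a::euclidean_space \<Rightarrow> 'b::euclidean_space"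
  assumes "coordinate_map \<pi>"
  shows "definable_map \<pi>"
proof -
  obtain \<beta> where \<beta>: "\<And>b. b \<in> Basis \<Longrightarrow> \<beta> b \<in> Basis \<and> (\<forall>x. \<pi> x \<bullet> b = x \<bullet> \<beta> b)"
    using assms unfolding coordinate_map_def by metis
  have "definable {p::'a \<times> 'b. \<forall>b\<in>Basis. p \<bullet> (0, b) = p \<bullet> (\<beta> b, 0)}"
    by (intro definable_Ball_finite definable_coordinate_eq) (use \<beta> in \<open>auto simp: Basis_prod_def\<close>)
  then show ?thesis unfolding definable_map_def using \<beta>
    by (simp add: euclidean_eq_iff[of "snd _"] inner_prod_def)
qed

lemma definable_vimage:
  fixes g :: "'a::euclidean_space \<Rightarrow> 'b::euclidean_space"
  assumes "definable A" "definable_map g"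
  shows "definable {x. g x \<in> A}"
proof -
  have "definable {x. \<exists>y. y = g x \<and> y \<in> A}"
    using assms(2) unfolding definable_map_def
    by (intro definable_ex definable_conj definable_coordinate_vimage[OF assms(1)] coordinate_map_intros)
  then show ?thesis by simp
qed

lemma definable_pred_comp:
  "definable {x. P x} \<Longrightarrow> definable_map g \<Longrightarrow> definable {x. P (g x)}"
  using definable_vimage[of "{x. P x}" g] by simp

lemma definable_map_comp:
  fixes g :: "'a::euclidean_space \<Rightarrow> 'b::euclidean_space"
    and h :: "'b \<Rightarrow> 'c::euclidean_space"
  assumes g: "definable_map g" and h: "definable_map h"
  shows "definable_map (\<lambda>x. h (g x))"
proof -
  have 1: "definable {q :: ('a \<times> 'c) \<times> 'b. snd q = g (fst (fst q))}"
    using definable_coordinate_vimage[OF g[unfolded definable_map_def], of "\<lambda>q. (fst (fst q), snd q)"]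
    by (simp add: coordinate_map_intros)
  have 2: "definable {q :: ('a \<times> 'c) \<times> 'b. snd (fst q) = h (snd q)}"
    using definable_coordinate_vimage[OF h[unfolded definable_map_def], of "\<lambda>q. (snd q, snd (fst q))"]
    by (simp add: coordinate_map_intros)
  have "definable {p. \<exists>y. y = g (fst p) \<and> snd p = h y}"
    by (intro definable_ex definable_conj 1 2)
  then show ?thesis unfolding definable_map_def by simp
qed

lemma definable_map_componentwise:
  fixes g :: "'a::euclidean_space \<Rightarrow> 'b::euclidean_space"
  assumes "\<And>b. b \<in> Basis \<Longrightarrow> definable_map (\<lambda>x. g x \<bullet> b)"
  shows "definable_map g"
proof -
  have "definable {p. snd p \<bullet> b = g (fst p) \<bullet> b}" if b: "b \<in> Basis" for b
  proof -
    have "definable {p. (fst p, snd p \<bullet> b) \<in> {q. snd q = g (fst q) \<bullet> b}}"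
      by (intro definable_coordinate_vimage[OF assms[unfolded definable_map_def, OF b]]
        coordinate_map_intros b)
    then show ?thesis by simp
  qed
  then have "definable {p. \<forall>b\<in>Basis. snd p \<bullet> b = g (fst p) \<bullet> b}"
    by (intro definable_Ball_finite) auto
  then show ?thesis unfolding definable_map_def by (simp add: euclidean_eq_iff[of "snd _"])
qed

lemma definable_map_id: "definable_map (\<lambda>x. x)"
  by (intro coordinate_map_definable coordinate_map_intros)

lemma definable_map_fst: "definable_map g \<Longrightarrow> definable_map (\<lambda>x. fst (g x))"
  by (rule definable_map_comp[OF _ coordinate_map_definable[OF coordinate_map_fst[OF coordinate_map_id]]])

lemma definable_map_snd: "definable_map g \<Longrightarrow> definable_map (\<lambda>x. snd (g x))"
  by (rule definable_map_comp[OF _ coordinate_map_definable[OF coordinate_map_snd[OF coordinate_map_id]]])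

lemma definable_map_Basis:
  "b \<in> Basis \<Longrightarrow> definable_map g \<Longrightarrow> definable_map (\<lambda>x. g x \<bullet> b)"
  by (rule definable_map_comp[OF _ coordinate_map_definable[OF coordinate_map_inner[OF coordinate_map_id]]])

lemma definable_map_Pair:
  fixes g :: "'a::euclidean_space \<Rightarrow> 'b::euclidean_space"
    and h :: "'a \<Rightarrow> 'c::euclidean_space"
  assumes "definable_map g" "definable_map h"
  shows "definable_map (\<lambda>x. (g x, h x))"
proof (rule definable_map_componentwise)
  fix b :: "'b \<times> 'c" assume "b \<in> Basis"
  moreover have "definable_map (\<lambda>x. g x \<bullet> u)" if "u \<in> Basis" for u
    using that assms(1) by (rule definable_map_Basis)
  moreover have "definable_map (\<lambda>x. h x \<bullet> u)" if "u \<in> Basis" for u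
    using that assms(2) by (rule definable_map_Basis)
  ultimately show "definable_map (\<lambda>x. (g x, h x) \<bullet> b)" by (auto simp: Basis_prod_def)
qed

lemma definable_map_const: "definable_map (\<lambda>x::'a::euclidean_space. c::'b::euclidean_space)"
proof (rule definable_map_componentwise)
  fix b :: 'b
  \<comment> \<open>Real constants enter as parameters through the axiom \<open>o_minimal\<close>: a
    singleton is an interval.\<close>
  have "is_interval {r} \<and> finite {{r}}" for r :: real by (auto simp: is_interval_1)
  then have "(\<lambda>x. [x]) ` \<Union>{{c \<bullet> b}} \<in> S 1" unfolding o_minimal by blast
  then have "definable {p :: 'a \<times> real. map (\<lambda>b. p \<bullet> b) [(0, 1)] \<in> (\<lambda>x. [x]) ` \<Union>{{c \<bullet> b}}}"
    by (intro definable_coordinates) (auto simp: Basis_prod_def)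
  moreover have "{p :: 'a \<times> real. map (\<lambda>b. p \<bullet> b) [(0, 1)] \<in> (\<lambda>x. [x]) ` \<Union>{{c \<bullet> b}}}
    = {p. snd p = c \<bullet> b}" by (auto simp: inner_prod_def)
  ultimately show "definable_map (\<lambda>x::'a. c \<bullet> b)" unfolding definable_map_def by simp
qed

lemma definable_map_add_real:
  fixes g h :: "'a::euclidean_space \<Rightarrow> real"
  assumes "definable_map g" "definable_map h" shows "definable_map (\<lambda>x. g x + h x)"
proof -
  have "definable {p :: (real \<times> real) \<times> real. map (\<lambda>b. p \<bullet> b) [((1,0),0),((0,1),0),(0,1)]
     \<in> {[x, y, x + y] |x y. True}}"
    by (intro definable_coordinates) (use add in \<open>auto simp: Basis_prod_def numeral_3_eq_3\<close>)
  moreover have "{p :: (real \<times> real) \<times> real. map (\<lambda>b. p \<bullet> b) [((1,0),0),((0,1),0),(0,1)]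
     \<in> {[x, y, x + y] |x y. True}} = {p. snd p = fst (fst p) + snd (fst p)}"
    by (auto simp: inner_prod_def)
  ultimately have "definable_map (\<lambda>p::real \<times> real. fst p + snd p)"
    unfolding definable_map_def by simp
  from definable_map_comp[OF definable_map_Pair[OF assms] this] show ?thesis by simp
qed

lemma definable_map_mult:
  fixes g h :: "'a::euclidean_space \<Rightarrow> real"
  assumes "definable_map g" "definable_map h" shows "definable_map (\<lambda>x. g x * h x)"
proof -
  have "definable {p :: (real \<times> real) \<times> real. map (\<lambda>b. p \<bullet> b) [((1,0),0),((0,1),0),(0,1)]
     \<in> {[x, y, x * y] |x y. True}}"
    by (intro definable_coordinates) (use mult in \<open>auto simp: Basis_prod_def numeral_3_eq_3\<close>)
  moreover have "{p :: (real \<times> real) \<times> real. map (\<lambda>b. p \<bullet> b) [((1,0),0),((0,1),0),(0,1)]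
     \<in> {[x, y, x * y] |x y. True}} = {p. snd p = fst (fst p) * snd (fst p)}"
    by (auto simp: inner_prod_def)
  ultimately have "definable_map (\<lambda>p::real \<times> real. fst p * snd p)"
    unfolding definable_map_def by simp
  from definable_map_comp[OF definable_map_Pair[OF assms] this] show ?thesis by simp
qed

lemma definable_less:
  fixes g h :: "'a::euclidean_space \<Rightarrow> real"
  assumes "definable_map g" "definable_map h" shows "definable {x. g x < h x}"
proof -
  have "definable {p :: real \<times> real. map (\<lambda>b. p \<bullet> b) [(1,0),(0,1)] \<in> {[x, y] |x y. x < y}}"
    by (intro definable_coordinates) (use less in \<open>auto simp: Basis_prod_def numeral_2_eq_2\<close>)
  moreover have "{p :: real \<times> real. map (\<lambda>b. p \<bullet> b) [(1,0),(0,1)] \<in> {[x, y] |x y. x < y}}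
     = {p. fst p < snd p}"
    by (auto simp: inner_prod_def)
  ultimately have "definable {p::real \<times> real. fst p < snd p}" by simp
  from definable_pred_comp[OF this definable_map_Pair[OF assms]] show ?thesis by simp
qed

lemma definable_le:
  fixes g h :: "'a::euclidean_space \<Rightarrow> real"
  assumes "definable_map g" "definable_map h" shows "definable {x. g x \<le> h x}"
  using definable_not[OF definable_less[OF assms(2,1)]] by (simp add: not_less)

lemma definable_eq:
  fixes g h :: "'a::euclidean_space \<Rightarrow> 'b::euclidean_space"
  assumes "definable_map g" "definable_map h" shows "definable {x. g x = h x}"
  using definable_vimage[OF assms(1)[unfolded definable_map_def], of "\<lambda>x. (x, h x)"]
    definable_map_Pair[OF definable_map_id assms(2)] by (simp add: eq_commute[of "h _"])

lemma definable_map_diff_real: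
  fixes g h :: "'a::euclidean_space \<Rightarrow> real"
  assumes "definable_map g" "definable_map h" shows "definable_map (\<lambda>x. g x - h x)"
  using definable_map_add_real[OF assms(1) definable_map_mult[OF definable_map_const[of "-1"] assms(2)]]
  by simp

lemma definable_map_diff:
  fixes g h :: "'a::euclidean_space \<Rightarrow> 'b::euclidean_space"
  assumes "definable_map g" "definable_map h" shows "definable_map (\<lambda>x. g x - h x)"
  by (rule definable_map_componentwise)
     (auto simp: inner_diff_left intro!: definable_map_diff_real definable_map_Basis assms)

lemma definable_map_sum:
  fixes g :: "'i \<Rightarrow> 'a::euclidean_space \<Rightarrow> real"
  assumes "\<And>i. i \<in> I \<Longrightarrow> definable_map (g i)"
  shows "definable_map (\<lambda>x. \<Sum>i\<in>I. g i x)"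
  using assms
  by (induction I rule: infinite_finite_induct)
     (auto intro: definable_map_const definable_map_add_real)

lemma definable_map_inner:
  fixes g h :: "'a::euclidean_space \<Rightarrow> 'b::euclidean_space"
  assumes "definable_map g" "definable_map h" shows "definable_map (\<lambda>x. g x \<bullet> h x)"
proof -
  have "definable_map (\<lambda>x. \<Sum>b\<in>Basis. (g x \<bullet> b) * (h x \<bullet> b))"
    by (intro definable_map_sum definable_map_mult definable_map_Basis assms)
  then show ?thesis by (simp only: euclidean_inner[symmetric])
qed

lemma definable_map_norm:
  fixes g :: "'a::euclidean_space \<Rightarrow> 'b::euclidean_space"
  assumes "definable_map g" shows "definable_map (\<lambda>x. norm (g x))"
proof -
  \<comment> \<open>The square root is expressed by its defining property: a nonnegative number with
    prescribed square.\<close>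
  have "definable {p. 0 \<le> snd p \<and> snd p * snd p = g (fst p) \<bullet> g (fst p)}"
    by (intro definable_conj definable_le definable_eq definable_map_const definable_map_mult
      definable_map_inner definable_map_id definable_map_fst definable_map_snd
      definable_map_comp[OF _ assms])
  moreover have "(0 \<le> r \<and> r * r = y \<bullet> y) = (r = norm y)" for r and y :: 'b
    by (metis dot_square_norm norm_ge_zero power2_eq_square power2_eq_imp_eq)
  ultimately show ?thesis unfolding definable_map_def by simp
qed

text \<open>Applied along the syntax of a first-order formula, these rules show that the set it
  describes is definable.\<close>

lemmas definable_intros = definable_ex definable_all definable_conj definable_disj definable_not
  definable_imp definable_less definable_le definable_eq definable_map_const
  definable_map_Pair definable_map_fst definable_map_snd definable_map_id
  definable_map_mult definable_map_add_real definable_map_diff definable_map_inner definable_map_norm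

end

section \<open>Monotonicity of definable functions of one variable\<close>

text \<open>
  An open interval with rational endpoints can isolate at most one such point, while the points of an
  interval are uncountable; so o-minimality is not needed here.
\<close>

lemma no_one_sided_local_minima:
  fixes a b :: real
  assumes "a < b"
    and loc: "\<And>x. x \<in> {a<..<b} \<Longrightarrow>
      \<exists>e>0. (\<forall>y. x - e < y \<and> y < x \<longrightarrow> P y x) \<and> (\<forall>y. x < y \<and> y < x + e \<longrightarrow> Q x y)"
    and contra: "\<And>x y. P x y \<Longrightarrow> Q x y \<Longrightarrow> False"
  shows False
proof -
  obtain e where e: "\<And>x. x \<in> {a<..<b} \<Longrightarrow> e x > 0 \<and>
     (\<forall>y. x - e x < y \<and> y < x \<longrightarrow> P y x) \<and> (\<forall>y. x < y \<and> y < x + e x \<longrightarrow> Q x y)"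
    using loc by metis
  have "\<exists>p::rat. x - e x < of_rat p \<and> of_rat p < x" if "x \<in> {a<..<b}" for x
    by (rule of_rat_dense) (use e[OF that] in simp)
  then obtain p :: "real \<Rightarrow> rat" where p: "\<And>x. x \<in> {a<..<b} \<Longrightarrow>
      x - e x < of_rat (p x) \<and> of_rat (p x) < x"
    by metis
  have "\<exists>q::rat. x < of_rat q \<and> of_rat q < x + e x" if "x \<in> {a<..<b}" for x
    by (rule of_rat_dense) (use e[OF that] in simp)
  then obtain q :: "real \<Rightarrow> rat" where q: "\<And>x. x \<in> {a<..<b} \<Longrightarrow>
      x < of_rat (q x) \<and> of_rat (q x) < x + e x"
    by metis
  have neq: "(p x, q x) \<noteq> (p y, q y)" if "x \<in> {a<..<b}" "y \<in> {a<..<b}" "x < y" for x y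
  proof
    assume eq: "(p x, q x) = (p y, q y)"
    have "y < x + e x" using q[OF that(1)] q[OF that(2)] eq by auto
    moreover have "y - e y < x" using p[OF that(1)] p[OF that(2)] eq by auto
    ultimately have "Q x y" "P x y" using e[OF that(1)] e[OF that(2)] that(3) by auto
    then show False using contra by blast
  qed
  have "inj_on (\<lambda>x. (p x, q x)) {a<..<b}"
  proof (rule inj_onI)
    fix x y assume "x \<in> {a<..<b}" "y \<in> {a<..<b}" "(p x, q x) = (p y, q y)"
    then show "x = y" using neq[of x y] neq[of y x] by (cases x y rule: linorder_cases) auto
  qed
  then have "countable {a<..<b}" by (rule countable_image_inj_on[rotated]) simp
  then show False using uncountable_open_interval[of a b] \<open>a < b\<close> by simp
qed

text \<open>A supremum argument: let \<open>c\<close> be the supremum of the points up to which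
  \<open>g\<close> stays above \<open>g u\<close>. The left half of the condition at
  \<open>c\<close> gives \<open>g u \<le> g c\<close>, and the right half would carry the bound
  beyond \<open>c\<close> if \<open>c < v\<close>.\<close>

lemma mono_on_if_locally_mono:
  fixes g :: "real \<Rightarrow> real"
  assumes loc: "\<And>x. x \<in> {a<..<b} \<Longrightarrow>
      \<exists>e>0. (\<forall>y. x - e < y \<and> y < x \<longrightarrow> g y \<le> g x) \<and> (\<forall>y. x < y \<and> y < x + e \<longrightarrow> g x \<le> g y)"
  shows "mono_on {a<..<b} g"
proof (rule mono_onI)
  fix u v assume u: "u \<in> {a<..<b}" and v: "v \<in> {a<..<b}" and "u \<le> v"
  define T where "T = {s. u \<le> s \<and> s \<le> v \<and> (\<forall>y. u \<le> y \<and> y \<le> s \<longrightarrow> g u \<le> g y)}"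
  have uT: "u \<in> T" unfolding T_def using \<open>u \<le> v\<close> by (auto dest: antisym)
  have bT: "bdd_above T" unfolding T_def by (auto simp: bdd_above_def)
  define c where "c = Sup T"
  have uc: "u \<le> c" unfolding c_def by (rule cSup_upper[OF uT bT])
  have cv: "c \<le> v" unfolding c_def by (rule cSup_least) (use uT in \<open>auto simp: T_def\<close>)
  have below: "g u \<le> g y" if y: "u \<le> y" "y < c" for y
  proof -
    obtain s where "s \<in> T" "y < s" using y(2) uT less_cSup_iff[OF _ bT] unfolding c_def by blast
    then show ?thesis using y unfolding T_def by auto
  qed
  obtain e where e: "e > 0" "\<And>y. c - e < y \<Longrightarrow> y < c \<Longrightarrow> g y \<le> g c"
    "\<And>y. c < y \<Longrightarrow> y < c + e \<Longrightarrow> g c \<le> g y"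
    using loc[of c] uc cv u v by auto
  have gc: "g u \<le> g c"
  proof (cases "u = c")
    case False
    define y where "y = max u (c - e / 2)"
    have "u \<le> y" "y < c" "c - e < y" using False uc e(1) by (auto simp: y_def)
    then show ?thesis using below[of y] e(2)[of y] by linarith
  qed simp
  have "c = v"
  proof (rule ccontr)
    assume "c \<noteq> v"
    define s where "s = min v (c + e / 2)"
    have s: "c < s" "s \<le> v" "s < c + e" using \<open>c \<noteq> v\<close> cv e(1) by (auto simp: s_def)
    have "g u \<le> g y" if "u \<le> y" "y \<le> s" for y
      using below[of y] gc e(3)[of y] that s by (cases y c rule: linorder_cases) auto
    then have "s \<in> T" using s uc by (auto simp: T_def)
    then have "s \<le> c" unfolding c_def by (rule cSup_upper[OF _ bT])
    then show False using s by simp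
  qed
  then show "g u \<le> g v" using gc by simp
qed

text \<open>An interval that meets every one-sided neighbourhood of \<open>a\<close> contains all
  points between \<open>a\<close> and any of its members on that side.\<close>

lemma interval_germ:
  fixes I :: "real set"
  assumes "is_interval I"
  shows "\<exists>e>0. {a<..<a+e} \<subseteq> I \<or> {a<..<a+e} \<inter> I = {}"
    and "\<exists>e>0. {a-e<..<a} \<subseteq> I \<or> {a-e<..<a} \<inter> I = {}"
proof -
  show "\<exists>e>0. {a<..<a+e} \<subseteq> I \<or> {a<..<a+e} \<inter> I = {}"
  proof (cases "\<exists>e>0. {a<..<a+e} \<inter> I = {}")
    case False
    then obtain y where y: "y \<in> I" "a < y" by (metis disjoint_iff greaterThanLessThan_iff zero_less_one)
    have "x \<in> I" if "a < x" "x < y" for x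
    proof -
      have "{a<..<a+(x-a)} \<inter> I \<noteq> {}" using False that(1) by (metis diff_gt_0_iff_gt)
      then obtain z where "z \<in> I" "z < x" by auto
      then show ?thesis using assms y that unfolding is_interval_1 by (meson less_imp_le)
    qed
    then show ?thesis by (intro exI[of _ "y - a"]) (use y in auto)
  qed auto
  show "\<exists>e>0. {a-e<..<a} \<subseteq> I \<or> {a-e<..<a} \<inter> I = {}"
  proof (cases "\<exists>e>0. {a-e<..<a} \<inter> I = {}")
    case False
    then obtain y where y: "y \<in> I" "y < a" by (metis disjoint_iff greaterThanLessThan_iff zero_less_one)
    have "x \<in> I" if "y < x" "x < a" for x
    proof -
      have "{a-(a-x)<..<a} \<inter> I \<noteq> {}" using False that(2) by (metis diff_gt_0_iff_gt)
      then obtain z where "z \<in> I" "x < z" by auto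
      then show ?thesis using assms y that unfolding is_interval_1 by (meson less_imp_le)
    qed
    then show ?thesis by (intro exI[of _ "a - y"]) (use y in auto)
  qed auto
qed

context o_minimal_structure
begin

lemma definable_real_Union:
  fixes A :: "real set"
  assumes "definable A"
  obtains F where "finite F" "\<And>I. I \<in> F \<Longrightarrow> is_interval I" "A = \<Union>F"
proof -
  have "(\<lambda>x. map (\<lambda>b. x \<bullet> b) [1]) ` A \<in> S DIM(real)"
    using assms by (rule definable_image_coordinates) auto
  then have "(\<lambda>x. [x]) ` A \<in> S 1" by simp
  then obtain F where F: "finite F" "\<forall>I\<in>F. is_interval I" "(\<lambda>x. [x]) ` A = (\<lambda>x. [x]) ` \<Union>F"
    unfolding o_minimal by blast
  have "inj (\<lambda>x::real. [x])" by (simp add: inj_def)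
  then have "A = \<Union>F" using F(3) inj_image_eq_iff by blast
  then show ?thesis using F(1,2) by (intro that[of F]) auto
qed

text \<open>The finiteness in o-minimality enters here: each of the finitely many intervals is
  decided close to the right of \<open>a\<close>, and the least of the radii decides their
  union.\<close>

lemma definable_germ_right:
  fixes P :: "real \<Rightarrow> bool"
  assumes "definable {x. P x}"
  shows "\<exists>e>0. (\<forall>x. a < x \<and> x < a + e \<longrightarrow> P x) \<or> (\<forall>x. a < x \<and> x < a + e \<longrightarrow> \<not> P x)"
proof -
  obtain F where F: "finite F" "\<And>I. I \<in> F \<Longrightarrow> is_interval I" "{x. P x} = \<Union>F"
    using definable_real_Union[OF assms] by blast
  have "\<exists>e>0. {a<..<a+e} \<subseteq> \<Union>F \<or> {a<..<a+e} \<inter> \<Union>F = {}"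
    using F(1,2)
  proof (induction F rule: finite_induct)
    case empty
    show ?case by (intro exI[of _ 1]) auto
  next
    case (insert I F)
    obtain e where e: "e > 0" "{a<..<a+e} \<subseteq> \<Union>F \<or> {a<..<a+e} \<inter> \<Union>F = {}" using insert by auto
    obtain d where d: "d > 0" "{a<..<a+d} \<subseteq> I \<or> {a<..<a+d} \<inter> I = {}"
      using interval_germ(1)[of I a] insert by auto
    have "{a<..<a + min d e} \<subseteq> {a<..<a+e}" "{a<..<a + min d e} \<subseteq> {a<..<a+d}" by auto
    then show ?case using d e by (intro exI[of _ "min d e"]) auto
  qed
  then obtain e where e: "e > 0" "{a<..<a+e} \<subseteq> {x. P x} \<or> {a<..<a+e} \<inter> {x. P x} = {}"
    unfolding F(3) by blast
  then show ?thesis by (intro exI[of _ e]) auto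
qed

lemma definable_germ_left:
  fixes P :: "real \<Rightarrow> bool"
  assumes "definable {x. P x}"
  shows "\<exists>e>0. (\<forall>x. a - e < x \<and> x < a \<longrightarrow> P x) \<or> (\<forall>x. a - e < x \<and> x < a \<longrightarrow> \<not> P x)"
proof -
  have "definable {x::real. P (- x)}"
    using definable_pred_comp[OF assms definable_map_diff[OF definable_map_const[of 0] definable_map_id]]
    by simp
  then obtain e where e: "e > 0"
    "(\<forall>x. -a < x \<and> x < -a + e \<longrightarrow> P (-x)) \<or> (\<forall>x. -a < x \<and> x < -a + e \<longrightarrow> \<not> P (-x))"
    using definable_germ_right[of "\<lambda>x. P (-x)" "-a"] by auto
  from e(2) have "(\<forall>x. a - e < x \<and> x < a \<longrightarrow> P x) \<or> (\<forall>x. a - e < x \<and> x < a \<longrightarrow> \<not> P x)"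
  proof
    assume *: "\<forall>x. -a < x \<and> x < -a + e \<longrightarrow> P (-x)"
    have "P x" if "a - e < x \<and> x < a" for x using *[rule_format, of "-x"] that by auto
    then show ?thesis by blast
  next
    assume *: "\<forall>x. -a < x \<and> x < -a + e \<longrightarrow> \<not> P (-x)"
    have "\<not> P x" if "a - e < x \<and> x < a" for x using *[rule_format, of "-x"] that by auto
    then show ?thesis by blast
  qed
  with e(1) show ?thesis by blast
qed

text \<open>A one-sided form of the monotonicity theorem. \<open>L\<close> and \<open>R\<close>
  compare \<open>g x\<close> with the values close to the left and right of \<open>x\<close>; being
  first-order, each holds everywhere or nowhere just to the right of \<open>a\<close>. If both or
  neither hold, local monotonicity globalizes; in the mixed cases every point would be a local
  extremum that is strict on one side.\<close>

theorem definable_eventually_monotone: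
  fixes g :: "real \<Rightarrow> real"
  assumes g: "definable_map g"
  shows "\<exists>b>a. mono_on {a<..<b} g \<or> antimono_on {a<..<b} g"
proof -
  define L where "L x \<longleftrightarrow> (\<exists>e. 0 < e \<and> (\<forall>y. x - e < y \<and> y < x \<longrightarrow> g y \<le> g x))" for x
  define R where "R x \<longleftrightarrow> (\<exists>e. 0 < e \<and> (\<forall>y. x < y \<and> y < x + e \<longrightarrow> g x \<le> g y))" for x
  note intros = definable_intros definable_map_comp[OF _ g]
  have dL: "definable {x. L x}" unfolding L_def by (intro intros)
  have dR: "definable {x. R x}" unfolding R_def by (intro intros)
  have nL: "\<exists>e>0. \<forall>y. x - e < y \<and> y < x \<longrightarrow> g x < g y" if "\<not> L x" for x
  proof -
    have "definable {y. g y \<le> g x}" by (intro intros)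
    then obtain e where "e > 0" "(\<forall>y. x - e < y \<and> y < x \<longrightarrow> g y \<le> g x) \<or>
        (\<forall>y. x - e < y \<and> y < x \<longrightarrow> \<not> g y \<le> g x)"
      using definable_germ_left[of "\<lambda>y. g y \<le> g x" x] by blast
    then show ?thesis using that unfolding L_def not_le by blast
  qed
  have nR: "\<exists>e>0. \<forall>y. x < y \<and> y < x + e \<longrightarrow> g y < g x" if "\<not> R x" for x
  proof -
    have "definable {y. g x \<le> g y}" by (intro intros)
    then obtain e where "e > 0" "(\<forall>y. x < y \<and> y < x + e \<longrightarrow> g x \<le> g y) \<or>
        (\<forall>y. x < y \<and> y < x + e \<longrightarrow> \<not> g x \<le> g y)"
      using definable_germ_right[of "\<lambda>y. g x \<le> g y" x] by blast
    then show ?thesis using that unfolding R_def not_le by blast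
  qed
  have combine: "\<exists>e>0. (\<forall>y. x - e < y \<and> y < x \<longrightarrow> P y) \<and> (\<forall>y. x < y \<and> y < x + e \<longrightarrow> Q y)"
    if PQ: "\<exists>e>0. \<forall>y. x - e < y \<and> y < x \<longrightarrow> P y" "\<exists>e>0. \<forall>y. x < y \<and> y < x + e \<longrightarrow> Q y"
    for x :: real and P Q
  proof -
    obtain d where d: "d > 0" "\<forall>y. x - d < y \<and> y < x \<longrightarrow> P y" using PQ(1) by blast
    obtain e where e: "e > 0" "\<forall>y. x < y \<and> y < x + e \<longrightarrow> Q y" using PQ(2) by blast
    show ?thesis by (intro exI[of _ "min d e"]) (use d e in auto)
  qed
  obtain d where d: "d > 0" "(\<forall>x. a < x \<and> x < a + d \<longrightarrow> L x) \<or> (\<forall>x. a < x \<and> x < a + d \<longrightarrow> \<not> L x)"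
    using definable_germ_right[OF dL] by blast
  obtain e where e: "e > 0" "(\<forall>x. a < x \<and> x < a + e \<longrightarrow> R x) \<or> (\<forall>x. a < x \<and> x < a + e \<longrightarrow> \<not> R x)"
    using definable_germ_right[OF dR] by blast
  define b where "b = a + min d e"
  have "a < b" using d(1) e(1) by (simp add: b_def)
  have Lb: "(\<forall>x\<in>{a<..<b}. L x) \<or> (\<forall>x\<in>{a<..<b}. \<not> L x)" using d(2) by (auto simp: b_def)
  have Rb: "(\<forall>x\<in>{a<..<b}. R x) \<or> (\<forall>x\<in>{a<..<b}. \<not> R x)" using e(2) by (auto simp: b_def)
  consider "\<forall>x\<in>{a<..<b}. L x" "\<forall>x\<in>{a<..<b}. R x" | "\<forall>x\<in>{a<..<b}. \<not> L x" "\<forall>x\<in>{a<..<b}. \<not> R x"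
    | "\<forall>x\<in>{a<..<b}. L x" "\<forall>x\<in>{a<..<b}. \<not> R x" | "\<forall>x\<in>{a<..<b}. \<not> L x" "\<forall>x\<in>{a<..<b}. R x"
    using Lb Rb by blast
  then have "mono_on {a<..<b} g \<or> antimono_on {a<..<b} g"
  proof cases
    case 1
    then have "mono_on {a<..<b} g"
      by (intro mono_on_if_locally_mono combine) (simp_all add: L_def R_def)
    then show ?thesis ..
  next
    case 2
    have "mono_on {a<..<b} (\<lambda>x. - g x)"
    proof (intro mono_on_if_locally_mono combine)
      fix x assume x: "x \<in> {a<..<b}"
      show "\<exists>e>0. \<forall>y. x - e < y \<and> y < x \<longrightarrow> - g y \<le> - g x"
        using nL[of x] 2(1) x by (meson less_imp_le neg_le_iff_le)
      show "\<exists>e>0. \<forall>y. x < y \<and> y < x + e \<longrightarrow> - g x \<le> - g y"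
        using nR[of x] 2(2) x by (meson less_imp_le neg_le_iff_le)
    qed
    then have "antimono_on {a<..<b} g" by (auto simp: monotone_on_def)
    then show ?thesis ..
  next
    case 3
    have False
    proof (rule no_one_sided_local_minima[OF \<open>a < b\<close>, of "\<lambda>x y. g x \<le> g y" "\<lambda>x y. g y < g x"])
      fix x assume x: "x \<in> {a<..<b}"
      show "\<exists>e>0. (\<forall>y. x - e < y \<and> y < x \<longrightarrow> g y \<le> g x) \<and> (\<forall>y. x < y \<and> y < x + e \<longrightarrow> g y < g x)"
        by (rule combine) (use 3 x nR[of x] in \<open>auto simp: L_def\<close>)
    qed simp
    then show ?thesis ..
  next
    case 4
    have False
    proof (rule no_one_sided_local_minima[OF \<open>a < b\<close>, of "\<lambda>x y. g y < g x" "\<lambda>x y. g x \<le> g y"])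
      fix x assume x: "x \<in> {a<..<b}"
      show "\<exists>e>0. (\<forall>y. x - e < y \<and> y < x \<longrightarrow> g x < g y) \<and> (\<forall>y. x < y \<and> y < x + e \<longrightarrow> g x \<le> g y)"
        by (rule combine) (use 4 x nL[of x] in \<open>auto simp: R_def\<close>)
    qed simp
    then show ?thesis ..
  qed
  with \<open>a < b\<close> show ?thesis by blast
qed

end

section \<open>Definable selection and proximal sequences\<close>

text \<open>Along the decreasing values \<open>r k\<close> a monotone \<open>h\<close> yields a
  bounded monotone sequence, whose increments telescope. As \<open>h\<close> is monotone only on
  \<open>{0<..<b}\<close>, a shift by \<open>N\<close> first discards finitely many terms.\<close>

lemma summable_variation_monotone:
  fixes h :: "real \<Rightarrow> real"
  assumes mono: "mono_on {0<..<b} h \<or> antimono_on {0<..<b} h" and "0 < b"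
    and r: "decseq r" "\<And>k. 0 < r k" "r \<longlonglongrightarrow> 0"
    and bound: "\<And>k. \<bar>h (r k)\<bar> \<le> K"
  shows "summable (\<lambda>k. \<bar>h (r (Suc k)) - h (r k)\<bar>)"
proof -
  obtain N where N: "r k < b" if "k \<ge> N" for k
    using order_tendstoD(2)[OF r(3) \<open>0 < b\<close>] unfolding eventually_sequentially by blast
  have rN: "r (k + N) \<in> {0<..<b}" for k using N r(2) by simp
  have dec: "r (Suc k + N) \<le> r (k + N)" for k using r(1) by (simp add: decseq_Suc_iff)
  define y where "y k = h (r (k + N))" for k
  have "Bseq y" by (rule BseqI'[of _ K]) (use bound in \<open>simp add: y_def\<close>)
  have "summable (\<lambda>k. \<bar>y (Suc k) - y k\<bar>)"
    using mono
  proof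
    assume m: "mono_on {0<..<b} h"
    have le: "y (Suc k) \<le> y k" for k
      unfolding y_def using mono_onD[OF m rN rN dec] .
    then have "convergent y"
      using \<open>Bseq y\<close> by (intro Bseq_monoseq_convergent) (auto simp: monoseq_Suc)
    then obtain l where "y \<longlonglongrightarrow> l" unfolding convergent_def by blast
    from telescope_summable[OF this] have "summable (\<lambda>k. - (y (Suc k) - y k))"
      by (rule summable_minus)
    then show ?thesis using le by (simp add: abs_of_nonpos)
  next
    assume m: "antimono_on {0<..<b} h"
    have le: "y k \<le> y (Suc k)" for k
      unfolding y_def using monotone_onD[OF m rN rN dec] by simp
    then have "convergent y"
      using \<open>Bseq y\<close> by (intro Bseq_monoseq_convergent) (auto simp: monoseq_Suc)
    then obtain l where "y \<longlonglongrightarrow> l" unfolding convergent_def by blast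
    from telescope_summable[OF this] show ?thesis using le by simp
  qed
  then have "summable (\<lambda>k. \<bar>h (r (Suc (k + N))) - h (r (k + N))\<bar>)" by (simp add: y_def)
  then show ?thesis
    using summable_iff_shift[of "\<lambda>k. \<bar>h (r (Suc k)) - h (r k)\<bar>" N] by simp
qed

text \<open>Summing the recursion bounds a partial sum of \<open>d\<close> by half of itself plus a
  constant, and the half is absorbed on the left.\<close>

lemma summable_of_contraction_step:
  fixes d e :: "nat \<Rightarrow> real"
  assumes d: "\<And>k. 0 \<le> d k" and e: "\<And>k. 0 \<le> e k" "summable e"
    and step: "\<And>k. d (Suc k) \<le> d k / 2 + e k"
  shows "summable d"
proof (rule summableI_nonneg_bounded)
  fix n
  have "sum d {..<Suc n} = d 0 + (\<Sum>k<n. d (Suc k))" by (rule sum.lessThan_Suc_shift)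
  also have "\<dots> \<le> d 0 + (\<Sum>k<n. d k / 2 + e k)" by (intro add_left_mono sum_mono step)
  also have "\<dots> = d 0 + sum d {..<n} / 2 + sum e {..<n}"
    by (simp add: sum.distrib sum_divide_distrib)
  also have "sum e {..<n} \<le> suminf e" by (rule sum_le_suminf) (use e in auto)
  finally have "sum d {..<n} + d n \<le> d 0 + sum d {..<n} / 2 + suminf e" by simp
  then show "sum d {..<n} \<le> 2 * (d 0 + suminf e)" using d[of n] by simp
qed (rule d)

lemma convergent_of_summable_increments:
  fixes x :: "nat \<Rightarrow> 'a::banach"
  assumes "summable (\<lambda>k. norm (x (Suc k) - x k))"
  shows "convergent x"
proof -
  have "summable (\<lambda>k. x (Suc k) - x k)" by (rule summable_norm_cancel[OF assms])
  then have "(\<lambda>n. \<Sum>k<n. x (Suc k) - x k) \<longlonglongrightarrow> (\<Sum>k. x (Suc k) - x k)"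
    by (rule summable_LIMSEQ)
  then have "(\<lambda>n. (x n - x 0) + x 0) \<longlonglongrightarrow> (\<Sum>k. x (Suc k) - x k) + x 0"
    unfolding sum_lessThan_telescope by (intro tendsto_intros)
  then show ?thesis by (auto simp: convergent_def)
qed

section \<open>Definable choice from compact fibres, and its application to proximal
  sequences\<close>

context o_minimal_structure
begin

text \<open>Minimality is a first-order condition, hence definable, and a closed one, hence the
  fibres stay compact. The construction can therefore be repeated in further directions.\<close>

lemma definable_fibrewise_argmin:
  fixes A :: "('a::euclidean_space \<times> 'b::euclidean_space) set"
  assumes A: "definable A" and cpt: "\<And>r. compact {x. (r, x) \<in> A}"
  shows "\<exists>B\<subseteq>A. definable B \<and> (\<forall>r. compact {x. (r, x) \<in> B}) \<and>
    (\<forall>r x. (r, x) \<in> A \<longrightarrow> (\<exists>y. (r, y) \<in> B)) \<and>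
    (\<forall>r x y. (r, x) \<in> B \<longrightarrow> (r, y) \<in> A \<longrightarrow> x \<bullet> v \<le> y \<bullet> v)"
proof -
  define B where "B = {p. p \<in> A \<and> (\<forall>y. (fst p, y) \<in> A \<longrightarrow> snd p \<bullet> v \<le> y \<bullet> v)}"
  show ?thesis
  proof (intro exI[of _ B] conjI allI impI)
    show "B \<subseteq> A" by (auto simp: B_def)
    show "definable B" unfolding B_def by (intro definable_intros definable_vimage[OF A])
    show "compact {x. (r, x) \<in> B}" for r
    proof -
      have "closed (\<Inter>y\<in>{y. (r, y) \<in> A}. {x. x \<bullet> v \<le> y \<bullet> v})"
        by (intro closed_INT ballI closed_Collect_le continuous_intros)
      moreover have "{x. (r, x) \<in> B} =
          {x. (r, x) \<in> A} \<inter> (\<Inter>y\<in>{y. (r, y) \<in> A}. {x. x \<bullet> v \<le> y \<bullet> v})"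
        by (auto simp: B_def)
      ultimately show ?thesis using cpt[of r] by (simp add: compact_Int_closed)
    qed
    show "\<exists>y. (r, y) \<in> B" if "(r, x) \<in> A" for r x
    proof -
      have "\<exists>y\<in>{x. (r, x) \<in> A}. \<forall>z\<in>{x. (r, x) \<in> A}. y \<bullet> v \<le> z \<bullet> v"
        by (rule continuous_attains_inf[OF cpt]) (use that in \<open>auto intro!: continuous_intros\<close>)
      then show ?thesis by (auto simp: B_def)
    qed
    show "x \<bullet> v \<le> y \<bullet> v" if "(r, x) \<in> B" "(r, y) \<in> A" for r x y
      using that by (auto simp: B_def)
  qed
qed

text \<open>Minimizing along one vector after another fixes the corresponding coordinates; over a
  full basis a single point remains in each nonempty fibre.\<close>

lemma definable_lexicographic_argmin:
  fixes A :: "('a::euclidean_space \<times> 'b::euclidean_space) set"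
  assumes "definable A" "\<And>r. compact {x. (r, x) \<in> A}"
  shows "\<exists>B\<subseteq>A. definable B \<and> (\<forall>r x. (r, x) \<in> A \<longrightarrow> (\<exists>y. (r, y) \<in> B)) \<and>
    (\<forall>r x y. \<forall>b\<in>set bs. (r, x) \<in> B \<longrightarrow> (r, y) \<in> B \<longrightarrow> x \<bullet> b = y \<bullet> b)"
  using assms
proof (induction bs arbitrary: A)
  case Nil
  then show ?case by (intro exI[of _ A]) auto
next
  case (Cons b bs)
  obtain A' where A': "A' \<subseteq> A" "definable A'"
    and cpt: "\<forall>r. compact {x. (r, x) \<in> A'}"
    and ex: "\<forall>r x. (r, x) \<in> A \<longrightarrow> (\<exists>y. (r, y) \<in> A')"
    and le: "\<forall>r x y. (r, x) \<in> A' \<longrightarrow> (r, y) \<in> A \<longrightarrow> x \<bullet> b \<le> y \<bullet> b"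
    using definable_fibrewise_argmin[OF Cons.prems, of b] by (elim exE conjE) (rule that)
  obtain B where B: "B \<subseteq> A'" "definable B"
    and B_ex: "\<forall>r x. (r, x) \<in> A' \<longrightarrow> (\<exists>y. (r, y) \<in> B)"
    and B_eq: "\<forall>r x y. \<forall>c\<in>set bs. (r, x) \<in> B \<longrightarrow> (r, y) \<in> B \<longrightarrow> x \<bullet> c = y \<bullet> c"
    using Cons.IH[OF A'(2) cpt[rule_format]] by (elim exE conjE) (rule that)
  have B_b: "x \<bullet> b = y \<bullet> b" if "(r, x) \<in> B" "(r, y) \<in> B" for r x y
    using le[rule_format, of r x y] le[rule_format, of r y x] that A'(1) B(1)
    by (meson antisym subsetD)
  show ?case
  proof (intro exI[of _ B] conjI allI ballI impI)
    show "B \<subseteq> A" "definable B" using A'(1) B by auto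
    show "\<exists>y. (r, y) \<in> B" if "(r, x) \<in> A" for r x
      using ex[rule_format, OF that] B_ex by blast
    show "x \<bullet> c = y \<bullet> c" if "c \<in> set (b # bs)" "(r, x) \<in> B" "(r, y) \<in> B" for r x y c
      using that B_b[of r x y] B_eq[rule_format, of c r x y] by auto
  qed
qed

text \<open>Definable choice with a preference: the direction \<open>v\<close> is minimized first,
  and lexicographic minimization breaks the remaining ties.\<close>

theorem definable_selection_minimizing:
  fixes A :: "('a::euclidean_space \<times> 'b::euclidean_space) set"
  assumes A: "definable A" "\<And>r. compact {x. (r, x) \<in> A}"
  obtains g where "definable_map g" "\<And>r x. (r, x) \<in> A \<Longrightarrow> (r, g r) \<in> A \<and> g r \<bullet> v \<le> x \<bullet> v"
proof -
  obtain A' where A': "A' \<subseteq> A" "definable A'"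
    and cpt: "\<forall>r. compact {x. (r, x) \<in> A'}"
    and ex: "\<forall>r x. (r, x) \<in> A \<longrightarrow> (\<exists>y. (r, y) \<in> A')"
    and le: "\<forall>r x y. (r, x) \<in> A' \<longrightarrow> (r, y) \<in> A \<longrightarrow> x \<bullet> v \<le> y \<bullet> v"
    using definable_fibrewise_argmin[OF A, of v] by (elim exE conjE) (rule that)
  obtain bs :: "'b list" where bs: "set bs = Basis" using ex_Basis_list by blast
  obtain B where B: "B \<subseteq> A'" "definable B"
    and B_ex: "\<forall>r x. (r, x) \<in> A' \<longrightarrow> (\<exists>y. (r, y) \<in> B)"
    and B_eq: "\<forall>r x y. \<forall>b\<in>Basis. (r, x) \<in> B \<longrightarrow> (r, y) \<in> B \<longrightarrow> x \<bullet> b = y \<bullet> b"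
    using definable_lexicographic_argmin[OF A'(2) cpt[rule_format], of bs] unfolding bs
    by (elim exE conjE) (rule that)
  have unique: "x = y" if "(r, x) \<in> B" "(r, y) \<in> B" for r x y
    by (rule euclidean_eqI) (rule B_eq[rule_format, OF _ that])
  \<comment> \<open>The value 0 over empty fibres makes the map total; the graph remains definable
    because emptiness of a fibre is first-order.\<close>
  define g where "g r = (if \<exists>x. (r, x) \<in> B then THE x. (r, x) \<in> B else 0)" for r
  have g: "g r = x" if "(r, x) \<in> B" for r x
    using that unique by (auto simp: g_def intro!: the_equality)
  have "definable {p. p \<in> B \<or> \<not> (\<exists>y. (fst p, y) \<in> B) \<and> snd p = 0}"
    by (intro definable_intros definable_vimage[OF B(2)])
  moreover have "(p \<in> B \<or> \<not> (\<exists>y. (fst p, y) \<in> B) \<and> snd p = 0) = (snd p = g (fst p))" for p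
  proof (cases "\<exists>y. (fst p, y) \<in> B")
    case True
    then show ?thesis using g by (metis prod.collapse)
  next
    case False
    then have "g (fst p) = 0" by (simp add: g_def)
    then show ?thesis using False by (metis prod.collapse)
  qed
  ultimately have "definable_map g" unfolding definable_map_def by simp
  moreover have "(r, g r) \<in> A \<and> g r \<bullet> v \<le> x \<bullet> v" if x: "(r, x) \<in> A" for r x
  proof -
    obtain y where "(r, y) \<in> B" using ex[rule_format, OF x] B_ex by blast
    then have "(r, g r) \<in> A'" using g B(1) by auto
    then show ?thesis using A'(1) le x by blast
  qed
  ultimately show ?thesis by (rule that)
qed

text \<open>\<open>descent\<close> is a sufficient decrease of \<open>F\<close>; \<open>prox\<close>
  says that at the new iterate the slope of \<open>F\<close>, measured through \<open>\<pi>\<close>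
  and up to a quadratic error, is at most \<open>C\<close> times the last step. Both see the
  iterates only through \<open>\<pi>\<close>, so it is the images that converge.\<close>

theorem definable_proximal_sequence_convergent:
  fixes Z :: "'z::euclidean_space set" and F :: "'z \<Rightarrow> real"
    and \<pi> :: "'z \<Rightarrow> 'x::euclidean_space" and z :: "nat \<Rightarrow> 'z"
  assumes Z: "compact Z" "definable Z"
    and F: "continuous_on Z F" "definable_map F"
    and \<pi>: "continuous_on Z \<pi>" "definable_map \<pi>"
    and zZ: "\<And>k. z k \<in> Z" and c: "0 < c" and C: "0 \<le> C"
    and descent: "\<And>k. F (z (Suc k)) + c * (norm (\<pi> (z (Suc k)) - \<pi> (z k)))\<^sup>2 \<le> F (z k)"
    and prox: "\<And>k u. u \<in> Z \<Longrightarrow> F (z (Suc k)) - F u \<le>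
      C * norm (\<pi> (z (Suc k)) - \<pi> (z k)) * norm (\<pi> u - \<pi> (z (Suc k)))
      + C * (norm (\<pi> u - \<pi> (z (Suc k))))\<^sup>2"
  shows "convergent (\<lambda>k. \<pi> (z k))"
proof -
  define d where "d k = norm (\<pi> (z (Suc k)) - \<pi> (z k))" for k
  have d0: "0 \<le> d k" for k by (simp add: d_def)
  have dec: "decseq (\<lambda>k. F (z k))"
    unfolding decseq_Suc_iff
  proof
    fix k show "F (z (Suc k)) \<le> F (z k)"
      using descent[of k] zero_le_power2[of "d k"] c mult_nonneg_nonneg[of c "(d k)\<^sup>2"]
      unfolding d_def by linarith
  qed
  have "bounded (F ` Z)" by (intro compact_imp_bounded compact_continuous_image F Z)
  then obtain b where b: "\<And>x. x \<in> Z \<Longrightarrow> norm (F x) \<le> b" by (auto simp: bounded_iff)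
  have "bounded (\<pi> ` Z)" by (intro compact_imp_bounded compact_continuous_image \<pi> Z)
  then obtain b' where b': "\<And>x. x \<in> Z \<Longrightarrow> norm (\<pi> x) \<le> b'" by (auto simp: bounded_iff)
  have "b' \<ge> 0" using b'[OF zZ[of 0]] norm_ge_zero order_trans by blast
  obtain l where l: "(\<lambda>k. F (z k)) \<longlonglongrightarrow> l" "\<And>k. l \<le> F (z k)"
    using decseq_convergent[OF dec, of "- b"] b zZ by (metis abs_le_D2 minus_le_iff real_norm_def)
  \<comment> \<open>The excess value is taken at \<open>z (Suc k)\<close>, because
    \<open>prox\<close> bounds the slope only at the new iterate.\<close>
  define r where "r k = F (z (Suc k)) - l" for k
  have r_tendsto: "r \<longlonglongrightarrow> 0"
    unfolding r_def using tendsto_diff[OF LIMSEQ_Suc[OF l(1)] tendsto_const[of l]] by simp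
  have r_dec: "decseq r" using dec by (auto simp: r_def decseq_Suc_iff)
  show ?thesis
  proof (cases "\<exists>N. F (z N) = l")
    \<comment> \<open>The limit value is attained: from then on \<open>F\<close> is constant along
      the sequence, and \<open>descent\<close> makes every further step zero.\<close>
    case True
    then obtain N where N: "F (z N) = l" by blast
    have const: "\<pi> (z (N + k)) = \<pi> (z N)" for k
    proof (induction k)
      case (Suc k)
      have "F (z (N + k)) \<le> l" using decseqD[OF dec, of N "N + k"] N by simp
      then have "c * (d (N + k))\<^sup>2 \<le> 0" using descent[of "N + k"] l(2)[of "Suc (N + k)"]
        unfolding d_def by linarith
      then have "d (N + k) = 0" using c by (simp add: mult_le_0_iff)
      then show ?case using Suc by (simp add: d_def)
    qed simp
    have "(\<lambda>k. \<pi> (z (k + N))) \<longlonglongrightarrow> \<pi> (z N)"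
      using const by (simp add: add.commute)
    then show ?thesis using LIMSEQ_offset[of "\<lambda>k. \<pi> (z k)"] unfolding convergent_def by blast
  next
    case False
    then have r_pos: "0 < r k" for k using l(2)[of "Suc k"] unfolding r_def
      by (metis diff_gt_0_iff_gt order_le_less)
    \<comment> \<open>Every step is at most \<open>2 * b'\<close>, so \<open>s\<close> bounds all
      the slopes \<open>C * d k\<close>. Capping slopes at \<open>s\<close> makes the fibres of
      \<open>A\<close> compact.\<close>
    define s where "s = C * (2 * b')"
    \<comment> \<open>\<open>t\<close> bounds the slope of \<open>F\<close> at \<open>v\<close> up
      to the quadratic term of \<open>prox\<close>. The square is written as a product to match
      \<open>definable_intros\<close>.\<close>
    define slope where "slope t v \<longleftrightarrow>
      (\<forall>u. u \<in> Z \<longrightarrow> F v - F u \<le> t * norm (\<pi> u - \<pi> v) + C * (norm (\<pi> u - \<pi> v) * norm (\<pi> u - \<pi> v)))"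
      for t v
    \<comment> \<open>The fibre over \<open>\<rho>\<close> consists of slope bounds paired with
      points on the level \<open>\<rho> + l\<close> of \<open>F\<close>.\<close>
    define A where "A = {p :: real \<times> real \<times> 'z. 0 \<le> fst (snd p) \<and> fst (snd p) \<le> s \<and>
      snd (snd p) \<in> Z \<and> F (snd (snd p)) = fst p + l \<and> slope (fst (snd p)) (snd (snd p))}"
    have "definable A"
      unfolding A_def slope_def
      by (intro definable_intros definable_vimage[OF Z(2)] definable_map_comp[OF _ F(2)]
        definable_map_comp[OF _ \<pi>(2)])
    moreover have "compact {x. (\<rho>, x) \<in> A}" for \<rho>
    proof -
      let ?K = "{0..s} \<times> Z"
      have K: "compact ?K" by (intro compact_Times Z) simp
      have cont: "continuous_on ?K (\<lambda>x. F (snd x))" "continuous_on ?K (\<lambda>x. \<pi> (snd x))"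
        by (auto intro!: continuous_on_compose2[OF F(1)] continuous_on_compose2[OF \<pi>(1)]
          continuous_intros)
      have "closed {x \<in> ?K. F (snd x) = \<rho> + l}"
        by (intro continuous_closed_preimage_constant cont compact_imp_closed K)
      moreover have "closed {x \<in> ?K. F (snd x) - F u \<le> fst x * norm (\<pi> u - \<pi> (snd x))
          + C * (norm (\<pi> u - \<pi> (snd x)) * norm (\<pi> u - \<pi> (snd x)))}" for u
        by (intro continuous_on_closed_Collect_le continuous_intros cont compact_imp_closed K)
      ultimately have "closed ({x \<in> ?K. F (snd x) = \<rho> + l} \<inter>
          (\<Inter>u\<in>Z. {x \<in> ?K. F (snd x) - F u \<le> fst x * norm (\<pi> u - \<pi> (snd x))
          + C * (norm (\<pi> u - \<pi> (snd x)) * norm (\<pi> u - \<pi> (snd x)))}))"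
        by (intro closed_Int closed_INT) auto
      from compact_Int_closed[OF K this] show ?thesis
        by (rule back_subst[of compact]) (auto simp: A_def slope_def)
    qed
    \<comment> \<open>Minimizing along \<open>(1, 0)\<close> selects the least slope bound in each
      nonempty fibre.\<close>
    ultimately obtain g where g: "definable_map g"
      "\<And>\<rho> x. (\<rho>, x) \<in> A \<Longrightarrow> (\<rho>, g \<rho>) \<in> A \<and> g \<rho> \<bullet> (1, 0) \<le> x \<bullet> (1, 0)"
      using definable_selection_minimizing by metis
    have "d k \<le> 2 * b'" for k
      using norm_triangle_ineq4[of "\<pi> (z (Suc k))" "\<pi> (z k)"] b'[OF zZ[of k]] b'[OF zZ[of "Suc k"]]
      unfolding d_def by linarith
    \<comment> \<open>The iterate competes in its own fibre with the slope bound from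
      \<open>prox\<close>, so the least bound there is at most \<open>C * d k\<close>.\<close>
    then have "(r k, C * d k, z (Suc k)) \<in> A" for k
      using C d0 zZ prox[of _ k]
      by (simp add: A_def slope_def r_def s_def d_def mult_left_mono power2_eq_square)
    from g(2)[OF this] have gA: "(r k, g (r k)) \<in> A" and gle: "fst (g (r k)) \<le> C * d k" for k
      by (auto simp: inner_prod_def)
    define w where "w \<rho> = \<pi> (snd (g \<rho>))" for \<rho>
    define \<Delta> where "\<Delta> k = norm (w (r (Suc k)) - w (r k))" for k
    have w_def': "definable_map (\<lambda>\<rho>. w \<rho> \<bullet> b)" if "b \<in> Basis" for b
      unfolding w_def using that
      by (intro definable_map_Basis definable_map_comp[OF _ \<pi>(2)] definable_map_snd g(1))
    have gZ: "snd (g (r k)) \<in> Z" for k using gA[of k] by (auto simp: A_def)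
    have Fg: "F (snd (g (r k))) = r k + l" for k using gA[of k] by (auto simp: A_def)
    \<comment> \<open>Each coordinate of the curve is monotone close to the right of 0 and bounded
      along \<open>r\<close>, so its variation along \<open>r\<close> is finite.\<close>
    have "summable (\<lambda>k. \<bar>w (r (Suc k)) \<bullet> b - w (r k) \<bullet> b\<bar>)" if b: "b \<in> Basis" for b
    proof -
      obtain e where "e > 0" "mono_on {0<..<e} (\<lambda>\<rho>. w \<rho> \<bullet> b) \<or> antimono_on {0<..<e} (\<lambda>\<rho>. w \<rho> \<bullet> b)"
        using definable_eventually_monotone[OF w_def'[OF b], of 0] by blast
      moreover have "\<bar>w (r k) \<bullet> b\<bar> \<le> b'" for k
        using Basis_le_norm[OF b, of "w (r k)"] b'[OF gZ[of k]] by (simp add: w_def)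
      ultimately show ?thesis
        using summable_variation_monotone[of e "\<lambda>\<rho>. w \<rho> \<bullet> b" r b'] r_dec r_pos r_tendsto by blast
    qed
    then have "summable (\<lambda>k. \<Sum>b\<in>Basis. \<bar>w (r (Suc k)) \<bullet> b - w (r k) \<bullet> b\<bar>)"
      by (intro summable_sum)
    then have sum\<Delta>: "summable \<Delta>"
      by (rule summable_comparison_test[rotated])
        (use norm_le_l1[of "w (r (Suc _)) - w (r _)"] in \<open>auto simp: \<Delta>_def inner_diff_left\<close>)
    \<comment> \<open>Both \<open>a\<close> and its square dominate \<open>C / c\<close>, the latter
      because \<open>x \<le> (x + 1)\<^sup>2\<close> for nonnegative \<open>x\<close>.\<close>
    define a where "a = C / c + 1"
    have "0 < a" using c C by (simp add: a_def add_nonneg_pos)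
    have step: "d (Suc k) \<le> d k / 2 + a * \<Delta> k" for k
    proof -
      have D0: "0 \<le> \<Delta> k" by (simp add: \<Delta>_def)
      \<comment> \<open>Iterates and curve have equal values, so the decrease of \<open>F\<close>
        passes to the curve; there the slope inequality at the earlier point is tested against the
        next one.\<close>
      have "c * (d (Suc k))\<^sup>2 \<le> F (z (Suc k)) - F (z (Suc (Suc k)))"
        using descent[of "Suc k"] by (simp add: d_def)
      also have "\<dots> = F (snd (g (r k))) - F (snd (g (r (Suc k))))"
        unfolding Fg by (simp add: r_def)
      also have "\<dots> \<le> fst (g (r k)) * \<Delta> k + C * (\<Delta> k * \<Delta> k)"
        using gA[of k] gZ[of "Suc k"] by (auto simp: A_def slope_def \<Delta>_def w_def)
      also have "\<dots> \<le> C * d k * \<Delta> k + C * (\<Delta> k * \<Delta> k)"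
        using gle[of k] D0 by (simp add: mult_right_mono)
      also have "\<dots> = c * ((C / c) * (d k * \<Delta> k + (\<Delta> k)\<^sup>2))"
        using c by (simp add: field_simps power2_eq_square)
      finally have "(d (Suc k))\<^sup>2 \<le> (C / c) * (d k * \<Delta> k + (\<Delta> k)\<^sup>2)"
        using mult_le_cancel_left_pos[OF c] by blast
      also have "\<dots> \<le> a * (d k * \<Delta> k) + a\<^sup>2 * (\<Delta> k)\<^sup>2"
      proof -
        have "C / c \<le> a" "0 \<le> C / c" using c C by (auto simp: a_def)
        moreover have "x \<le> (x + 1)\<^sup>2" if "0 \<le> x" for x :: real
          using that by (simp add: power2_sum)
        ultimately have "C / c \<le> a\<^sup>2" unfolding a_def by blast
        then show ?thesis
          unfolding distrib_left using \<open>C / c \<le> a\<close> d0[of k] D0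
          by (intro add_mono mult_right_mono) auto
      qed
      \<comment> \<open>Completing the square; the surplus is
        \<open>(d k / 2)\<^sup>2\<close>.\<close>
      also have "\<dots> \<le> (d k / 2 + a * \<Delta> k)\<^sup>2"
        by (simp add: power2_sum power_mult_distrib algebra_simps)
      finally show ?thesis
        by (rule power2_le_imp_le) (use d0[of k] D0 \<open>0 < a\<close> in simp)
    qed
    have "summable d"
      by (rule summable_of_contraction_step[of d "\<lambda>k. a * \<Delta> k", OF d0 _ _ step])
        (use \<open>0 < a\<close> summable_mult[OF sum\<Delta>, of a] in \<open>auto simp: \<Delta>_def\<close>)
    then show ?thesis unfolding d_def by (rule convergent_of_summable_increments)
  qed
qed

end

section \<open>Bregman distances of Legendre functions\<close>

locale legendre_function =
  fixes f :: "'a::euclidean_space \<Rightarrow> ereal"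
  assumes legendre: "legendre_type f" and C2: "C2_pos_def_on f (interior (edom f))"
begin

definition G where "G = interior (edom f)"
definition fr where "fr x = real_of_ereal (f x)"
definition D where "D x y = fr x - fr y - grad f y \<bullet> (x - y)"

lemma not_MInf: "f x \<noteq> - \<infinity>"
  using legendre by (auto simp: legendre_type_def proper_convex_def Let_def)

lemma edom_iff: "x \<in> edom f \<longleftrightarrow> (\<exists>r. f x = ereal r)"
  using not_MInf[of x] by (cases "f x") (auto simp: edom_def)

lemma ereal_fr: "x \<in> edom f \<Longrightarrow> f x = ereal (fr x)"
  by (auto simp: edom_iff fr_def)

lemma open_G: "open G" by (simp add: G_def)

lemma G_subset: "G \<subseteq> edom f" unfolding G_def by (rule interior_subset)

text \<open>The effective domain is the projection of the convex epigraph, and convexity passes to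
  the interior.\<close>

lemma convex_G: "convex G"
proof -
  have "convex {(x, r). f x \<le> ereal r}"
    using legendre by (auto simp: legendre_type_def proper_convex_def Let_def)
  then have "convex (fst ` {(x, r). f x \<le> ereal r})"
    by (rule convex_linear_image[OF bounded_linear.linear[OF bounded_linear_fst]])
  moreover have "fst ` {(x, r). f x \<le> ereal r} = edom f"
  proof (intro equalityI subsetI)
    fix x assume "x \<in> edom f"
    then show "x \<in> fst ` {(x, r). f x \<le> ereal r}"
      using ereal_fr by (intro image_eqI[of _ _ "(x, fr x)"]) auto
  qed (auto simp: edom_def)
  ultimately show ?thesis unfolding G_def by (metis convex_interior)
qed

lemma bregman_eq: "x \<in> G \<Longrightarrow> y \<in> G \<Longrightarrow> bregman f x y = ereal (D x y)"
  using G_subset by (auto simp: bregman_def D_def ereal_fr subset_iff)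

definition hessian :: "'a \<Rightarrow> 'a \<Rightarrow>\<^sub>L 'a" where
  "hessian = (SOME H. continuous_on G H \<and>
     (\<forall>x\<in>G. GDERIV fr x :> grad f x \<and> (grad f has_derivative blinfun_apply (H x)) (at x) \<and>
       (\<forall>v. v \<noteq> 0 \<longrightarrow> 0 < v \<bullet> blinfun_apply (H x) v)))"

lemma hessian:
  shows continuous_on_hessian: "continuous_on G hessian"
    and GDERIV_fr: "x \<in> G \<Longrightarrow> GDERIV fr x :> grad f x"
    and has_derivative_grad: "x \<in> G \<Longrightarrow> (grad f has_derivative blinfun_apply (hessian x)) (at x)"
    and hessian_pos: "x \<in> G \<Longrightarrow> v \<noteq> 0 \<Longrightarrow> 0 < v \<bullet> blinfun_apply (hessian x) v"
  using someI_ex[OF C2[unfolded C2_pos_def_on_def, folded G_def fr_def], folded hessian_def] by auto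

lemma has_derivative_fr: "x \<in> G \<Longrightarrow> (fr has_derivative (\<lambda>h. h \<bullet> grad f x)) (at x)"
  using GDERIV_fr by (simp add: gderiv_def)

lemma continuous_on_fr: "continuous_on G fr"
  using has_derivative_fr by (meson continuous_at_imp_continuous_on has_derivative_continuous)

lemma continuous_on_grad: "continuous_on G (grad f)"
  using has_derivative_grad by (meson continuous_at_imp_continuous_on has_derivative_continuous)

lemma has_derivative_line:
  fixes g :: "'a \<Rightarrow> 'b::real_normed_vector"
  assumes "(g has_derivative g') (at (x + s *\<^sub>R v))"
  shows "((\<lambda>s. g (x + s *\<^sub>R v)) has_vector_derivative g' v) (at s)"
proof -
  have "((\<lambda>s. x + s *\<^sub>R v) has_derivative (\<lambda>h. h *\<^sub>R v)) (at s)"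
    by (auto intro!: derivative_eq_intros)
  from has_derivative_compose[OF this assms]
  have "((\<lambda>s. g (x + s *\<^sub>R v)) has_derivative (\<lambda>h. g' (h *\<^sub>R v))) (at s)" .
  moreover have "g' (h *\<^sub>R v) = h *\<^sub>R g' v" for h
    using has_derivative_linear[OF assms] by (rule linear_cmul)
  ultimately show ?thesis by (simp add: has_vector_derivative_def)
qed

lemma DERIV_fr_line:
  assumes "x + s *\<^sub>R v \<in> G"
  shows "((\<lambda>s. fr (x + s *\<^sub>R v)) has_real_derivative v \<bullet> grad f (x + s *\<^sub>R v)) (at s)"
  using has_derivative_line[OF has_derivative_fr[OF assms]]
  by (simp add: has_real_derivative_iff_has_vector_derivative)

section \<open>Identities, quadratic bounds and convexity of the Bregman distance\<close>

lemma D_self [simp]: "D x x = 0" by (simp add: D_def)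

lemma three_points: "D x z = D x y + D y z + (grad f y - grad f z) \<bullet> (x - y)"
  by (simp add: D_def algebra_simps)

lemma D_symmetrized: "D x y + D y x = (grad f x - grad f y) \<bullet> (x - y)"
  by (simp add: D_def algebra_simps)

text \<open>By compactness the Hessian form has a positive minimum \<open>m\<close> over
  \<open>K\<close> and the unit sphere. Integrating twice along the segment from \<open>y\<close> to
  \<open>x\<close>, which stays in the convex set \<open>K\<close>, gives the constant
  \<open>m / 2\<close>.\<close>

lemma D_lower_bound:
  assumes K: "compact K" "convex K" "K \<subseteq> G"
  obtains c where "0 < c" "\<And>x y. x \<in> K \<Longrightarrow> y \<in> K \<Longrightarrow> c * (norm (x - y))\<^sup>2 \<le> D x y"
proof (cases "K = {}")
  case True
  then show ?thesis using that[of 1] by auto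
next
  case False
  note H = continuous_on_hessian has_derivative_grad hessian_pos
  let ?P = "K \<times> sphere (0::'a) 1"
  have cpt: "compact ?P" by (intro compact_Times K) simp
  have ne: "?P \<noteq> {}" using False by simp
  have cont: "continuous_on ?P (\<lambda>p. snd p \<bullet> blinfun_apply (hessian (fst p)) (snd p))"
    by (intro continuous_intros continuous_on_compose2[OF H(1)]) (use K in auto)
  obtain p where p: "p \<in> ?P" and min: "\<forall>q\<in>?P.
      snd p \<bullet> blinfun_apply (hessian (fst p)) (snd p) \<le> snd q \<bullet> blinfun_apply (hessian (fst q)) (snd q)"
    by (rule bexE[OF continuous_attains_inf[OF cpt ne cont]])
  define m where "m = snd p \<bullet> blinfun_apply (hessian (fst p)) (snd p)"
  have "snd p \<noteq> 0" using p by auto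
  then have "0 < m" unfolding m_def by (intro H(3)) (use p K in auto)
  have m: "m * (norm v)\<^sup>2 \<le> v \<bullet> blinfun_apply (hessian x) v" if "x \<in> K" for x v
  proof (cases "v = 0")
    case False
    have "m \<le> (v /\<^sub>R norm v) \<bullet> blinfun_apply (hessian x) (v /\<^sub>R norm v)"
      unfolding m_def using min[rule_format, of "(x, v /\<^sub>R norm v)"] that False by simp
    also have "\<dots> = (v \<bullet> blinfun_apply (hessian x) v) / (norm v)\<^sup>2"
      by (simp add: blinfun.scaleR_right power2_eq_square divide_inverse)
    finally show ?thesis using False by (simp add: pos_le_divide_eq)
  qed simp
  show ?thesis
  proof (rule that[of "m / 2"])
    show "0 < m / 2" using \<open>0 < m\<close> by simp
    fix x y assume xy: "x \<in> K" "y \<in> K"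
    define v where "v = x - y"
    have seg: "y + s *\<^sub>R v \<in> K" if "0 \<le> s" "s \<le> 1" for s
    proof -
      have "y + s *\<^sub>R v = (1 - s) *\<^sub>R y + s *\<^sub>R x" by (simp add: v_def algebra_simps)
      then show ?thesis using convexD[OF K(2) xy(2,1), of "1 - s" s] that by simp
    qed
    have segG: "y + s *\<^sub>R v \<in> G" if "0 \<le> s" "s \<le> 1" for s using seg[OF that] K by blast
    \<comment> \<open>First integration: along the segment the directional derivative grows at least
      at the rate \<open>m * (norm v)\<^sup>2\<close>.\<close>
    have mono: "grad f y \<bullet> v \<le> grad f (y + s *\<^sub>R v) \<bullet> v - m * s * (norm v)\<^sup>2"
      if s: "0 \<le> s" "s \<le> 1" for s
    proof -
      have "(\<lambda>s. grad f (y + s *\<^sub>R v) \<bullet> v - m * s * (norm v)\<^sup>2) 0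
          \<le> (\<lambda>s. grad f (y + s *\<^sub>R v) \<bullet> v - m * s * (norm v)\<^sup>2) s"
      proof (rule DERIV_nonneg_imp_nondecreasing[OF s(1)])
        fix u assume "0 \<le> u" "u \<le> s"
        then have u: "0 \<le> u" "u \<le> 1" using s by auto
        have "((\<lambda>s. grad f (y + s *\<^sub>R v)) has_vector_derivative blinfun_apply (hessian (y + u *\<^sub>R v)) v) (at u)"
          by (rule has_derivative_line[OF H(2)[OF segG[OF u]]])
        then have "((\<lambda>s. grad f (y + s *\<^sub>R v) \<bullet> v) has_real_derivative
            blinfun_apply (hessian (y + u *\<^sub>R v)) v \<bullet> v) (at u)"
          unfolding has_real_derivative_iff_has_vector_derivative
          by (rule bounded_linear.has_vector_derivative[OF bounded_linear_inner_left])
        then have "((\<lambda>s. grad f (y + s *\<^sub>R v) \<bullet> v - m * s * (norm v)\<^sup>2) has_real_derivative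
            blinfun_apply (hessian (y + u *\<^sub>R v)) v \<bullet> v - m * (norm v)\<^sup>2) (at u)"
          by (auto intro!: derivative_eq_intros)
        moreover have "0 \<le> blinfun_apply (hessian (y + u *\<^sub>R v)) v \<bullet> v - m * (norm v)\<^sup>2"
          using m[OF seg[OF u], of v] by (simp add: inner_commute)
        ultimately show "\<exists>d. ((\<lambda>s. grad f (y + s *\<^sub>R v) \<bullet> v - m * s * (norm v)\<^sup>2)
            has_real_derivative d) (at u) \<and> 0 \<le> d" by blast
      qed
      then show ?thesis by simp
    qed
    \<comment> \<open>Second integration: the values of this nondecreasing function at 0 and 1
      differ by \<open>D x y - m / 2 * (norm v)\<^sup>2\<close>.\<close>
    have "(\<lambda>s. fr (y + s *\<^sub>R v) - s * (grad f y \<bullet> v) - m / 2 * s\<^sup>2 * (norm v)\<^sup>2) 0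
        \<le> (\<lambda>s. fr (y + s *\<^sub>R v) - s * (grad f y \<bullet> v) - m / 2 * s\<^sup>2 * (norm v)\<^sup>2) 1"
    proof (rule DERIV_nonneg_imp_nondecreasing[of "0::real" 1])
      fix u :: real assume u: "0 \<le> u" "u \<le> 1"
      have "((\<lambda>s. fr (y + s *\<^sub>R v) - s * (grad f y \<bullet> v) - m / 2 * s\<^sup>2 * (norm v)\<^sup>2)
         has_real_derivative v \<bullet> grad f (y + u *\<^sub>R v) - grad f y \<bullet> v - m * u * (norm v)\<^sup>2) (at u)"
        by (rule derivative_eq_intros DERIV_fr_line segG u refl | simp)+
      then show "\<exists>d. ((\<lambda>s. fr (y + s *\<^sub>R v) - s * (grad f y \<bullet> v) - m / 2 * s\<^sup>2 * (norm v)\<^sup>2)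
         has_real_derivative d) (at u) \<and> 0 \<le> d"
        using mono[OF u] by (intro exI conjI) (auto simp: inner_commute)
    qed simp
    then show "m / 2 * (norm (x - y))\<^sup>2 \<le> D x y" by (simp add: v_def D_def)
  qed
qed

lemma D_pos:
  assumes "x \<in> G" "y \<in> G" "x \<noteq> y" shows "0 < D x y"
proof -
  have "closed_segment x y \<subseteq> G" using assms convex_G by (simp add: closed_segment_subset)
  then obtain c where "0 < c" "c * (norm (x - y))\<^sup>2 \<le> D x y"
    using D_lower_bound[OF compact_segment convex_closed_segment] by (metis ends_in_segment)
  moreover have "0 < c * (norm (x - y))\<^sup>2" using \<open>0 < c\<close> assms by simp
  ultimately show ?thesis by linarith
qed

lemma D_nonneg: "x \<in> G \<Longrightarrow> y \<in> G \<Longrightarrow> 0 \<le> D x y"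
  using D_pos[of x y] by (cases "x = y") auto

lemma grad_lipschitz:
  assumes K: "compact K" "convex K" "K \<subseteq> G"
  obtains C where "0 \<le> C" "\<And>x y. x \<in> K \<Longrightarrow> y \<in> K \<Longrightarrow> norm (grad f x - grad f y) \<le> C * norm (x - y)"
proof -
  note H = continuous_on_hessian has_derivative_grad hessian_pos
  have "bounded (hessian ` K)"
    by (intro compact_imp_bounded compact_continuous_image K continuous_on_subset[OF H(1)])
  then obtain C where C: "0 < C" "\<And>x. x \<in> K \<Longrightarrow> norm (hessian x) \<le> C" by (auto simp: bounded_pos)
  have "norm (grad f x - grad f y) \<le> C * norm (x - y)" if "x \<in> K" "y \<in> K" for x y
  proof (rule differentiable_bound[OF K(2) _ _ that])
    show "(grad f has_derivative blinfun_apply (hessian z)) (at z within K)" if "z \<in> K" for z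
      using H(2) that K by (blast intro: has_derivative_at_withinI)
    show "onorm (blinfun_apply (hessian z)) \<le> C" if "z \<in> K" for z
      using C(2)[OF that] by (simp add: norm_blinfun.rep_eq)
  qed
  with C(1) that show ?thesis by (metis less_imp_le)
qed

text \<open>As \<open>D y x\<close> is nonnegative, \<open>D x y\<close> is at most the symmetrized
  distance, to which Cauchy-Schwarz applies.\<close>

lemma D_upper_bound:
  assumes "x \<in> G" "y \<in> G" "norm (grad f x - grad f y) \<le> C * norm (x - y)"
  shows "D x y \<le> C * (norm (x - y))\<^sup>2"
proof -
  have "D x y \<le> (grad f x - grad f y) \<bullet> (x - y)"
    using D_symmetrized[of x y] D_nonneg[OF assms(2,1)] by linarith
  also have "\<dots> \<le> norm (grad f x - grad f y) * norm (x - y)" by (rule norm_cauchy_schwarz)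
  also have "\<dots> \<le> C * norm (x - y) * norm (x - y)" using assms(3) by (rule mult_right_mono) simp
  finally show ?thesis by (simp add: power2_eq_square)
qed

text \<open>A positive definite Hessian is injective, hence invertible in finite dimension, and the
  open mapping theorem applies at \<open>x\<close>. This permits small moves in dual
  coordinates.\<close>

lemma grad_locally_surjective:
  assumes "x \<in> G" "0 < \<epsilon>"
  shows "grad f x \<in> interior (grad f ` (ball x \<epsilon> \<inter> G))"
proof -
  note H = continuous_on_hessian has_derivative_grad hessian_pos
  have lin: "linear (blinfun_apply (hessian x))" by (rule bounded_linear.linear[OF blinfun.bounded_linear_right])
  have "v = 0" if "blinfun_apply (hessian x) v = 0" for v
    using H(3)[OF assms(1), of v] that by (cases "v = 0") auto
  then have inj: "inj (blinfun_apply (hessian x))" using linear_injective_0[OF lin] by blast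
  then have "surj (blinfun_apply (hessian x))" by (rule linear_inj_imp_surj[OF lin])
  then obtain g' where g': "linear g'" "blinfun_apply (hessian x) \<circ> g' = id"
    using linear_surjective_right_inverse[OF lin] by blast
  show ?thesis
  proof (rule sussmann_open_mapping[OF open_G continuous_on_grad assms(1) H(2)[OF assms(1)] _ g'(2)])
    show "bounded_linear g'" using g'(1) by (simp add: linear_conv_bounded_linear)
    show "ball x \<epsilon> \<inter> G \<subseteq> G" by simp
    show "x \<in> interior (ball x \<epsilon> \<inter> G)" using assms open_G by (simp add: interior_open)
  qed
qed

text \<open>Convexity in the first argument between \<open>x\<close> and \<open>y\<close>, using
  that the distance vanishes at \<open>y\<close>. It follows from \<open>D x p\<close> and
  \<open>D y p\<close> being nonnegative at the intermediate point \<open>p\<close>: weighted by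
  \<open>s\<close> and \<open>1 - s\<close>, their gradient terms cancel.\<close>

lemma D_convex:
  assumes "x \<in> G" "y \<in> G" "0 \<le> s" "s \<le> 1"
  shows "D (y + s *\<^sub>R (x - y)) y \<le> s * D x y"
proof -
  define p where "p = y + s *\<^sub>R (x - y)"
  have "p = (1 - s) *\<^sub>R y + s *\<^sub>R x" by (simp add: p_def algebra_simps)
  then have pG: "p \<in> G" using convexD[OF convex_G assms(2,1), of "1 - s" s] assms by simp
  have "0 \<le> s * D x p + (1 - s) * D y p"
    using D_nonneg[OF assms(1) pG] D_nonneg[OF assms(2) pG] assms by simp
  also have "\<dots> = s * D x y - D p y - grad f p \<bullet> (s *\<^sub>R (x - p) + (1 - s) *\<^sub>R (y - p))
      + grad f y \<bullet> (s *\<^sub>R (x - y) - (p - y))"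
    by (simp add: D_def inner_diff_right inner_add_right algebra_simps)
  also have "s *\<^sub>R (x - p) + (1 - s) *\<^sub>R (y - p) = 0" by (simp add: p_def algebra_simps)
  also have "s *\<^sub>R (x - y) - (p - y) = 0" by (simp add: p_def)
  finally show ?thesis by (simp add: p_def)
qed

text \<open>Nonnegativity of \<open>D z y\<close> for \<open>z\<close> at distance
  \<open>\<epsilon>\<close> from \<open>x\<close> in the direction of \<open>grad f y\<close> bounds
  \<open>\<epsilon> * norm (grad f y)\<close> by \<open>D x y\<close> plus the oscillation of
  \<open>f\<close> near \<open>M\<close>.\<close>

lemma grad_bound_of_D_bound:
  assumes M: "compact M" "M \<subseteq> G"
  obtains R where "\<And>x y. x \<in> M \<Longrightarrow> y \<in> G \<Longrightarrow> D x y \<le> r \<Longrightarrow> norm (grad f y) \<le> R"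
proof -
  obtain \<epsilon> where \<epsilon>: "0 < \<epsilon>" "(\<Union>x\<in>M. cball x \<epsilon>) \<subseteq> G"
    using compact_subset_open_imp_cball_epsilon_subset[OF M(1) open_G M(2)] by blast
  have "bounded (fr ` (\<Union>x\<in>M. cball x \<epsilon>))"
    by (intro compact_imp_bounded compact_continuous_image continuous_on_subset[OF continuous_on_fr]
      \<epsilon> compact_minkowski_sum_cball M)
  then obtain B where B: "\<And>x z. x \<in> M \<Longrightarrow> dist x z \<le> \<epsilon> \<Longrightarrow> \<bar>fr z\<bar> \<le> B"
    unfolding bounded_iff by force
  have "norm (grad f y) \<le> (r + 2 * B) / \<epsilon>" if xy: "x \<in> M" "y \<in> G" "D x y \<le> r" for x y
  proof -
    \<comment> \<open>If the gradient vanishes, the quotient is 0 and \<open>z = x\<close>, which is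
      harmless.\<close>
    define z where "z = x + (\<epsilon> / norm (grad f y)) *\<^sub>R grad f y"
    have "dist x z \<le> \<epsilon>" using \<epsilon>(1) by (simp add: z_def dist_norm)
    then have "z \<in> (\<Union>x\<in>M. cball x \<epsilon>)" "\<bar>fr z\<bar> \<le> B" using B xy(1) by auto
    then have "z \<in> G" using \<epsilon>(2) by blast
    have "\<bar>fr x\<bar> \<le> B" using B[of x x] xy(1) \<epsilon>(1) by simp
    have "0 \<le> D z y" by (rule D_nonneg) (use xy \<open>z \<in> G\<close> in auto)
    also have "D z y = D x y + fr z - fr x - grad f y \<bullet> (z - x)"
      by (simp add: D_def inner_diff_right)
    also have "grad f y \<bullet> (z - x) = \<epsilon> * norm (grad f y)"
      by (simp add: z_def dot_square_norm power2_eq_square)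
    finally show ?thesis using xy(3) \<open>\<bar>fr z\<bar> \<le> B\<close> \<open>\<bar>fr x\<bar> \<le> B\<close> \<epsilon>(1)
      by (simp add: pos_le_divide_eq mult.commute)
  qed
  then show ?thesis by (rule that)
qed

text \<open>Steepness enters here: at a boundary limit the gradients would have to blow up.\<close>

lemma limit_in_G:
  assumes "\<And>n. y n \<in> G" "y \<longlonglongrightarrow> b" "\<And>n. norm (grad f (y n)) \<le> R"
  shows "b \<in> G"
proof (rule ccontr)
  assume "b \<notin> G"
  moreover have "b \<in> closure G" using assms(1,2) closure_sequential by blast
  ultimately have "b \<in> frontier G" using open_G by (simp add: frontier_def interior_open)
  then have "filterlim (\<lambda>i. norm (grad f (y i))) at_top sequentially"
    using legendre assms(1,2) unfolding legendre_type_def Let_def G_def by blast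
  then have "eventually (\<lambda>n. R + 1 \<le> norm (grad f (y n))) sequentially"
    by (simp add: filterlim_at_top)
  then obtain n where "R + 1 \<le> norm (grad f (y n))"
    using eventually_happens'[OF sequentially_bot] by blast
  then show False using assms(3)[of n] by linarith
qed

end

section \<open>The data set and its slices\<close>

lemma norm_snd_le_norm: "norm (snd z) \<le> norm z"
  by (cases z) (simp add: norm_snd_le)

locale data_slice = legendre_function f
  for f :: "'a::euclidean_space \<times> 'b::euclidean_space \<Rightarrow> ereal" +
  fixes \<eta> :: 'a
begin

definition \<phi> where "\<phi> x = fr x - \<eta> \<bullet> fst x"
text \<open>This becomes the data set once the mean of \<open>t1\<close> is identified with the
  first component of the gradient; \<open>\<eta>\<close> is the observed sample.\<close>

definition DD where "DD = {x \<in> G. fst (grad f x) = \<eta>}"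

lemma DD_G: "x \<in> DD \<Longrightarrow> x \<in> G" by (simp add: DD_def)

text \<open>The gradient at \<open>y\<close> has first component \<open>\<eta>\<close>, so that part
  of the linear term is absorbed into \<open>\<phi>\<close> and only the hidden components
  remain.\<close>

lemma D_eq_\<phi>:
  assumes "y \<in> DD"
  shows "D x y = \<phi> x - \<phi> y - snd (grad f y) \<bullet> (snd x - snd y)"
  using assms by (simp add: DD_def D_def \<phi>_def inner_prod_def inner_diff_right)

lemma D_eq_\<phi>_diff:
  assumes "y \<in> DD" "snd x = snd y" shows "D x y = \<phi> x - \<phi> y"
  using D_eq_\<phi>[OF assms(1), of x] assms(2) by simp

lemma pythagoras:
  assumes "y \<in> DD" "p \<in> DD" "snd x = snd y" shows "D x p = (\<phi> x - \<phi> y) + D y p"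
  using D_eq_\<phi>[OF assms(2), of x] D_eq_\<phi>[OF assms(2), of y] assms(3) by simp

text \<open>
  In the dual coordinates given by the gradient the data set is a piece of an affine subspace, so a
  projection can be moved along the free dual directions; this forces the natural parameters of the
  hidden part to be kept.
\<close>

lemma snd_projection:
  assumes x: "x \<in> G" and y: "y \<in> DD" and min: "\<And>p. p \<in> DD \<Longrightarrow> D x y \<le> D x p"
  shows "snd y = snd x"
proof (rule ccontr)
  define e where "e = snd x - snd y"
  assume "snd y \<noteq> snd x"
  then have "0 < norm e" by (simp add: e_def)
  \<comment> \<open>The radius \<open>norm e\<close> keeps the perturbed point \<open>p\<close> so
    close to \<open>y\<close> that the cost \<open>D y p\<close> stays below the gain
    \<open>\<tau> * (e \<bullet> e)\<close> of the dual shift.\<close>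
  have "open (interior (grad f ` (ball y (norm e) \<inter> G)))" by simp
  moreover have "grad f y \<in> interior (grad f ` (ball y (norm e) \<inter> G))"
    using grad_locally_surjective[OF DD_G[OF y] \<open>0 < norm e\<close>] .
  ultimately obtain \<delta> where \<delta>: "0 < \<delta>" "ball (grad f y) \<delta> \<subseteq> interior (grad f ` (ball y (norm e) \<inter> G))"
    using open_contains_ball by blast
  \<comment> \<open>The dual shift \<open>\<tau> *\<^sub>R e\<close> then has length
    \<open>\<delta> / 2\<close>, inside the ball where the gradient is onto.\<close>
  define \<tau> where "\<tau> = \<delta> / (2 * norm e)"
  have "0 < \<tau>" using \<delta>(1) \<open>0 < norm e\<close> by (simp add: \<tau>_def)
  have "norm (0 :: 'a, \<tau> *\<^sub>R e) = \<delta> / 2" using \<delta>(1) \<open>0 < norm e\<close> by (simp add: \<tau>_def norm_Pair)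
  then have "grad f y + (0, \<tau> *\<^sub>R e) \<in> ball (grad f y) \<delta>"
    using \<delta>(1) by (simp add: dist_norm norm_minus_commute)
  then have "grad f y + (0, \<tau> *\<^sub>R e) \<in> grad f ` (ball y (norm e) \<inter> G)"
    using \<delta>(2) interior_subset by blast
  then obtain p where p: "p \<in> ball y (norm e)" "p \<in> G" and "grad f y + (0, \<tau> *\<^sub>R e) = grad f p"
    by blast
  then have gp: "grad f p = grad f y + (0, \<tau> *\<^sub>R e)" by simp
  have pD: "p \<in> DD" using p gp y by (simp add: DD_def)
  have "D x p = D x y + D y p - \<tau> * (e \<bullet> e)"
    using three_points[of x p y] gp by (simp add: inner_prod_def e_def)
  moreover have "D y p \<le> \<tau> * (e \<bullet> (snd p - snd y))"
    using D_symmetrized[of p y] D_nonneg[OF p(2) DD_G[OF y]] gp by (simp add: inner_prod_def)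
  moreover have "\<tau> * (e \<bullet> (snd p - snd y)) < \<tau> * (e \<bullet> e)"
  proof -
    have "norm (snd p - snd y) \<le> norm (p - y)" using norm_snd_le_norm[of "p - y"] by simp
    also have "\<dots> < norm e" using p(1) by (simp add: dist_norm norm_minus_commute)
    finally have "norm e * norm (snd p - snd y) < norm e * norm e"
      using \<open>0 < norm e\<close> by simp
    then have "e \<bullet> (snd p - snd y) < e \<bullet> e" using norm_cauchy_schwarz[of e "snd p - snd y"]
      by (simp add: dot_square_norm power2_eq_square)
    then show ?thesis using \<open>0 < \<tau>\<close> by (rule mult_strict_left_mono)
  qed
  ultimately have "D x p < D x y" by linarith
  then show False using min[OF pD] by simp
qed

text \<open>Forwards, a difference of \<open>\<phi>\<close> within a slice is a Bregman distance;
  backwards, a minimum on an open slice is stationary. The right-hand side is first-order in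
  \<open>G\<close> and \<open>\<phi>\<close>.\<close>

lemma DD_iff_slice_minimizer:
  "y \<in> DD \<longleftrightarrow> y \<in> G \<and> (\<forall>u. (u, snd y) \<in> G \<longrightarrow> \<phi> y \<le> \<phi> (u, snd y))"
proof (intro iffI conjI allI impI)
  fix u assume "y \<in> DD" "(u, snd y) \<in> G"
  then show "\<phi> y \<le> \<phi> (u, snd y)"
    using D_nonneg[OF _ DD_G, of "(u, snd y)" y] D_eq_\<phi>_diff[of y "(u, snd y)"] by simp
next
  assume y: "y \<in> G \<and> (\<forall>u. (u, snd y) \<in> G \<longrightarrow> \<phi> y \<le> \<phi> (u, snd y))"
  then obtain d where d: "0 < d" "ball y d \<subseteq> G" using open_G open_contains_ball by blast
  \<comment> \<open>\<open>a\<close> is the gradient of \<open>\<phi>\<close> along the slice;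
    stationarity in its own direction yields \<open>a \<bullet> a = 0\<close>.\<close>
  define a where "a = fst (grad f y) - \<eta>"
  define v where "v = (a, 0 :: 'b)"
  have "((\<lambda>s. fr (y + s *\<^sub>R v) - s * (\<eta> \<bullet> a)) has_real_derivative v \<bullet> grad f (y + 0 *\<^sub>R v) - \<eta> \<bullet> a) (at 0)"
    using y by (auto intro!: derivative_eq_intros DERIV_fr_line)
  \<comment> \<open>This range of \<open>s\<close> keeps \<open>y + s *\<^sub>R v\<close> in the
    ball inside \<open>G\<close>; the \<open>+ 1\<close> covers \<open>v = 0\<close>.\<close>
  moreover have "\<forall>s. \<bar>0 - s\<bar> < d / (norm v + 1) \<longrightarrow>
      fr (y + 0 *\<^sub>R v) - 0 * (\<eta> \<bullet> a) \<le> fr (y + s *\<^sub>R v) - s * (\<eta> \<bullet> a)"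
  proof (intro allI impI)
    fix s :: real assume s: "\<bar>0 - s\<bar> < d / (norm v + 1)"
    have "norm (s *\<^sub>R v) \<le> \<bar>s\<bar> * (norm v + 1)" by (simp add: mult_left_mono)
    also have "\<dots> < d" using s by (simp add: pos_less_divide_eq add_nonneg_pos)
    finally have "y + s *\<^sub>R v \<in> G" using d(2) by (auto simp: dist_norm)
    moreover have "y + s *\<^sub>R v = (fst y + s *\<^sub>R a, snd y)" by (simp add: v_def prod_eq_iff)
    ultimately have "\<phi> y \<le> \<phi> (y + s *\<^sub>R v)" using y by simp
    then show "fr (y + 0 *\<^sub>R v) - 0 * (\<eta> \<bullet> a) \<le> fr (y + s *\<^sub>R v) - s * (\<eta> \<bullet> a)"
      by (simp add: \<phi>_def v_def inner_add_right zero_prod_def[symmetric])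
  qed
  moreover have "0 < d / (norm v + 1)" using d(1) by (simp add: add_nonneg_pos)
  ultimately have "v \<bullet> grad f (y + 0 *\<^sub>R v) - \<eta> \<bullet> a = 0" using DERIV_local_min by blast
  then have "a \<bullet> a = 0" by (simp add: v_def a_def inner_prod_def inner_diff_left inner_commute
      zero_prod_def[symmetric] algebra_simps)
  then show "y \<in> DD" using y by (simp add: DD_def a_def)
qed (simp add: DD_G)

section \<open>Compactness of the sublevel sets on pairs of model and data points\<close>

lemma continuous_on_\<phi>: "continuous_on G \<phi>"
  unfolding \<phi>_def[abs_def] by (intro continuous_intros continuous_on_fr)

definition Z where "Z M r = {z. fst z \<in> M \<and> snd z \<in> DD \<and> snd (fst z) = snd (snd z) \<and>
    \<phi> (fst z) - \<phi> (snd z) \<le> r}"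

text \<open>The quadratic bound near \<open>p\<close> and convexity make \<open>D y p\<close> grow
  at least at the linear rate \<open>c * \<rho>\<close> outside the ball of radius
  \<open>\<rho>\<close>, while on these pairs \<open>D y p\<close> is bounded.\<close>

lemma bounded_Z:
  assumes M: "compact M" "M \<subseteq> G" and ne: "p \<in> DD"
  shows "bounded (Z M r)"
proof -
  have pG: "p \<in> G" using DD_G[OF ne] .
  obtain \<rho> where \<rho>: "0 < \<rho>" "cball p \<rho> \<subseteq> G" using open_G pG open_contains_cball by blast
  obtain c where c: "0 < c" "\<And>x y. x \<in> cball p \<rho> \<Longrightarrow> y \<in> cball p \<rho> \<Longrightarrow> c * (norm (x - y))\<^sup>2 \<le> D x y"
    using D_lower_bound[OF compact_cball convex_cball \<rho>(2)] by metis
  have "bounded (\<phi> ` M)"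
    by (intro compact_imp_bounded compact_continuous_image continuous_on_subset[OF continuous_on_\<phi>] M)
  then obtain B where B: "\<And>x. x \<in> M \<Longrightarrow> \<bar>\<phi> x\<bar> \<le> B" by (auto simp: bounded_iff)
  obtain W where W: "\<And>x. x \<in> M \<Longrightarrow> norm x \<le> W"
    using compact_imp_bounded[OF M(1)] by (auto simp: bounded_iff)
  \<comment> \<open>A bound for \<open>D y p\<close>:
    \<open>\<phi> y \<le> \<phi> x \<le> B\<close>, and the hidden component of \<open>y\<close> is
    that of a point of \<open>M\<close>.\<close>
  define Q where "Q = B - \<phi> p + norm (snd (grad f p)) * (W + norm (snd p))"
  define L where "L = max \<rho> (Q / (c * \<rho>))"
  have dist_le: "norm (y - p) \<le> L" if z: "(x, y) \<in> Z M r" for x y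
  proof (cases "norm (y - p) \<le> \<rho>")
    case False
    have xy: "x \<in> M" "y \<in> DD" "snd x = snd y" using z by (auto simp: Z_def)
    have yG: "y \<in> G" using DD_G[OF xy(2)] .
    define s where "s = \<rho> / norm (y - p)"
    have s: "0 < s" "s \<le> 1" using False \<rho>(1) by (auto simp: s_def divide_simps)
    have n: "norm (s *\<^sub>R (y - p)) = \<rho>" using False \<rho>(1) by (auto simp: s_def)
    have "p + s *\<^sub>R (y - p) \<in> cball p \<rho>" using n by (simp add: dist_norm)
    then have "c * \<rho>\<^sup>2 \<le> D (p + s *\<^sub>R (y - p)) p"
      using c(2)[of "p + s *\<^sub>R (y - p)" p] n \<rho>(1) by simp
    also have "\<dots> \<le> s * D y p" by (rule D_convex) (use yG pG s in auto)
    also have "D y p \<le> Q"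
    proof -
      have "\<phi> y \<le> \<phi> x" using D_nonneg[of x y] D_eq_\<phi>_diff[OF xy(2,3)] M xy(1) yG by auto
      then have "\<phi> y \<le> B" using B[OF xy(1)] by linarith
      moreover have "- (snd (grad f p) \<bullet> (snd y - snd p)) \<le> norm (snd (grad f p)) * norm (snd y - snd p)"
        using norm_cauchy_schwarz[of "- snd (grad f p)" "snd y - snd p"] by simp
      moreover have "norm (snd y - snd p) \<le> W + norm (snd p)"
        using norm_triangle_ineq4[of "snd y" "snd p"] norm_snd_le_norm[of x] W[OF xy(1)] xy(3) by simp
      ultimately show ?thesis unfolding D_eq_\<phi>[OF ne] Q_def
        using mult_left_mono[of "norm (snd y - snd p)" "W + norm (snd p)" "norm (snd (grad f p))"] by force
    qed
    finally have "c * \<rho>\<^sup>2 \<le> s * Q" using s by simp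
    then have "c * \<rho>\<^sup>2 * norm (y - p) \<le> \<rho> * Q"
      using False \<rho>(1) by (simp add: s_def divide_simps split: if_splits)
    then have "norm (y - p) \<le> Q / (c * \<rho>)"
      using \<rho>(1) c(1) by (simp add: pos_le_divide_eq power2_eq_square mult.assoc mult.left_commute mult.commute[of "norm _"])
    then show ?thesis by (simp add: L_def)
  qed (simp add: L_def)
  show ?thesis
    unfolding bounded_iff
  proof (intro exI[of _ "W + (L + norm p)"] ballI)
    fix z assume z: "z \<in> Z M r"
    have "norm z \<le> norm (fst z) + norm (snd z)" using norm_Pair_le[of "fst z" "snd z"] by simp
    moreover have "norm (fst z) \<le> W" using W z by (auto simp: Z_def)
    moreover have "norm (snd z) \<le> L + norm p"
      using dist_le[of "fst z" "snd z"] z norm_triangle_sub[of "snd z" p] by simp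
    ultimately show "norm z \<le> W + (L + norm p)" by linarith
  qed
qed

text \<open>The danger is a limit outside \<open>G\<close>. On these pairs the difference of
  \<open>\<phi>\<close> is a Bregman distance, so its bound \<open>r\<close> bounds the gradients
  and steepness keeps the limit in \<open>G\<close>; the rest is continuity.\<close>

lemma closed_Z:
  assumes M: "compact M" "M \<subseteq> G"
  shows "closed (Z M r)"
  unfolding closed_sequential_limits
proof (intro allI impI, elim conjE)
  fix z l assume zZ: "\<forall>n. z n \<in> Z M r" and lim: "z \<longlonglongrightarrow> l"
  define x y a b where "x n = fst (z n)" and "y n = snd (z n)" and "a = fst l" and "b = snd l" for n
  have xa: "x \<longlonglongrightarrow> a" and yb: "y \<longlonglongrightarrow> b"
    unfolding x_def y_def a_def b_def using lim by (auto intro: tendsto_fst tendsto_snd)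
  have z: "x n \<in> M" "y n \<in> DD" "snd (x n) = snd (y n)" "\<phi> (x n) - \<phi> (y n) \<le> r" for n
    using zZ by (auto simp: Z_def x_def y_def)
  have yG: "y n \<in> G" for n using DD_G[OF z(2)] .
  have aM: "a \<in> M" using closed_sequentially[OF compact_imp_closed[OF M(1)]] z(1) xa by blast
  obtain R where R: "\<And>x y. x \<in> M \<Longrightarrow> y \<in> G \<Longrightarrow> D x y \<le> r \<Longrightarrow> norm (grad f y) \<le> R"
    using grad_bound_of_D_bound[OF M] by metis
  have "norm (grad f (y n)) \<le> R" for n
    using R[OF z(1)[of n] yG[of n]] D_eq_\<phi>_diff[OF z(2)[of n] z(3)[of n]] z(4)[of n] by simp
  then have bG: "b \<in> G" using limit_in_G[OF yG yb] by blast
  have "(\<lambda>n. grad f (y n)) \<longlonglongrightarrow> grad f b"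
    by (rule continuous_on_tendsto_compose[OF continuous_on_grad yb bG]) (simp add: yG)
  then have "(\<lambda>n. fst (grad f (y n))) \<longlonglongrightarrow> fst (grad f b)" by (rule tendsto_fst)
  moreover have "fst (grad f (y n)) = \<eta>" for n using z(2) by (simp add: DD_def)
  ultimately have "fst (grad f b) = \<eta>" by (simp add: LIMSEQ_const_iff)
  then have bD: "b \<in> DD" using bG by (simp add: DD_def)
  have "(\<lambda>n. snd (x n)) \<longlonglongrightarrow> snd a" "(\<lambda>n. snd (x n)) \<longlonglongrightarrow> snd b"
    unfolding z(3) using tendsto_snd[OF xa] tendsto_snd[OF yb] by (auto simp: z(3))
  then have ab: "snd a = snd b" by (rule LIMSEQ_unique)
  have "(\<lambda>n. \<phi> (x n)) \<longlonglongrightarrow> \<phi> a"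
    by (rule continuous_on_tendsto_compose[OF continuous_on_\<phi> xa]) (use aM M z(1) in \<open>auto intro: always_eventually\<close>)
  moreover have "(\<lambda>n. \<phi> (y n)) \<longlonglongrightarrow> \<phi> b"
    by (rule continuous_on_tendsto_compose[OF continuous_on_\<phi> yb bG]) (simp add: yG)
  ultimately have "(\<lambda>n. \<phi> (x n) - \<phi> (y n)) \<longlonglongrightarrow> \<phi> a - \<phi> b" by (rule tendsto_diff)
  then have "\<phi> a - \<phi> b \<le> r" by (rule LIMSEQ_le_const2) (use z(4) in auto)
  with aM bD ab show "l \<in> Z M r" by (simp add: Z_def a_def b_def)
qed

end

section \<open>Expectations in exponential families\<close>

lemma abs_le_exp_add_exp: "\<bar>x\<bar> \<le> exp x + exp (- x)" for x :: real
  using exp_ge_add_one_self[of x] exp_ge_add_one_self[of "-x"] exp_gt_zero[of x] exp_gt_zero[of "-x"]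
  by (cases "0 \<le> x") linarith+

lemma partition_fun_log_normalizer:
  assumes "log_normalizer \<mu> t k \<theta> = ereal r"
  shows "partition_fun \<mu> t k \<theta> = ennreal (exp r)"
proof (cases "partition_fun \<mu> t k \<theta>")
  case (real p)
  then show ?thesis using assms
    by (auto simp: log_normalizer_def ennreal_eq_0_iff split: if_splits)
qed (use assms in \<open>simp add: log_normalizer_def\<close>)

text \<open>
  The gradient identity needs no differentiation under the integral sign: as
  \<open>exp (f (\<theta> + s v) - f \<theta>) \<ge> 1 + s E[t \<bullet> v]\<close>
  with equality at \<open>s = 0\<close>, the derivatives of both sides at \<open>s = 0\<close> agree.
\<close>

lemma exp_expectation_eq_grad:
  fixes t :: "'x \<Rightarrow> 'a::euclidean_space"
  assumes [measurable]: "t \<in> borel_measurable \<mu>" "k \<in> borel_measurable \<mu>"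
    and finite: "\<And>\<theta>. \<theta> \<in> edom (log_normalizer \<mu> t k) \<Longrightarrow> log_normalizer \<mu> t k \<theta> = ereal (F \<theta>)"
    and \<theta>: "\<theta> \<in> interior (edom (log_normalizer \<mu> t k))"
    and deriv: "GDERIV F \<theta> :> g"
  shows "integrable (density \<mu> (\<lambda>x. ennreal (exp_density \<mu> t k \<theta> x))) t"
    and "exp_expectation \<mu> t k \<theta> t = g"
proof -
  let ?E = "edom (log_normalizer \<mu> t k)"
  define w where "w \<theta> x = exp (\<theta> \<bullet> t x + k x)" for \<theta> x
  have w_meas [measurable]: "w \<theta> \<in> borel_measurable \<mu>" for \<theta> unfolding w_def by measurable
  have w_int: "integrable \<mu> (w \<theta>)" "integral\<^sup>L \<mu> (w \<theta>) = exp (F \<theta>)" if "\<theta> \<in> ?E" for \<theta>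
  proof -
    have "(\<integral>\<^sup>+ x. ennreal (w \<theta> x) \<partial>\<mu>) = ennreal (exp (F \<theta>))"
      using partition_fun_log_normalizer[OF finite[OF that]] by (simp add: partition_fun_def w_def)
    then have "has_bochner_integral \<mu> (w \<theta>) (exp (F \<theta>))"
      by (intro has_bochner_integral_nn_integral) (auto simp: w_def)
    then show "integrable \<mu> (w \<theta>)" "integral\<^sup>L \<mu> (w \<theta>) = exp (F \<theta>)"
      by (auto simp: has_bochner_integral_iff)
  qed
  obtain d where d: "0 < d" "ball \<theta> d \<subseteq> ?E"
    using \<theta> mem_interior by blast
  have \<theta>E: "\<theta> \<in> ?E" using d by auto
  have w_add: "w (\<theta> + s *\<^sub>R v) x = w \<theta> x * exp (s * (t x \<bullet> v))" for s v x
    by (simp add: w_def exp_add[symmetric] inner_add_left inner_commute algebra_simps)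
  have dir: "integrable \<mu> (\<lambda>x. w \<theta> x * (t x \<bullet> v)) \<and>
      (LINT x|\<mu>. w \<theta> x * (t x \<bullet> v)) = exp (F \<theta>) * (v \<bullet> g)" for v
  proof
    define e where "e = d / (norm v + 1)"
    have e: "0 < e" using d(1) by (simp add: e_def add_nonneg_pos)
    have near: "\<theta> + s *\<^sub>R v \<in> ?E" if "\<bar>s\<bar> < e" for s
    proof -
      have "norm (s *\<^sub>R v) \<le> \<bar>s\<bar> * (norm v + 1)" by (simp add: mult_left_mono)
      also have "\<dots> < d" using that by (simp add: e_def pos_less_divide_eq add_nonneg_pos)
      finally show ?thesis using d(2) by (auto simp: dist_norm)
    qed
    have i: "integrable \<mu> (w (\<theta> + (e/2) *\<^sub>R v))" "integrable \<mu> (w (\<theta> + (- (e/2)) *\<^sub>R v))"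
      by (rule w_int(1)[OF near], use e in simp)+
    \<comment> \<open>A dominating function: the sum of the two exponentials controls the linear
      factor, and both shifted parameters still lie in the domain.\<close>
    have "integrable \<mu> (\<lambda>x. (w (\<theta> + (e/2) *\<^sub>R v) x + w (\<theta> + (- (e/2)) *\<^sub>R v) x) / (e/2))"
      by (rule integrable_divide) (rule Bochner_Integration.integrable_add[OF i])
    then show int: "integrable \<mu> (\<lambda>x. w \<theta> x * (t x \<bullet> v))"
    proof (rule Bochner_Integration.integrable_bound)
      show "AE x in \<mu>. norm (w \<theta> x * (t x \<bullet> v))
          \<le> norm ((w (\<theta> + (e/2) *\<^sub>R v) x + w (\<theta> + (- (e/2)) *\<^sub>R v) x) / (e/2))"
      proof (intro AE_I2)
        fix x
        have w0: "0 < w \<theta> x" by (simp add: w_def)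
        have "\<bar>t x \<bullet> v\<bar> = \<bar>e/2 * (t x \<bullet> v)\<bar> / (e/2)" using e by (simp add: abs_mult)
        also have "\<dots> \<le> (exp (e/2 * (t x \<bullet> v)) + exp (- (e/2 * (t x \<bullet> v)))) / (e/2)"
          by (intro divide_right_mono abs_le_exp_add_exp) (use e in simp)
        finally have "w \<theta> x * \<bar>t x \<bullet> v\<bar> \<le>
            w \<theta> x * ((exp (e/2 * (t x \<bullet> v)) + exp (- (e/2 * (t x \<bullet> v)))) / (e/2))"
          using w0 by (intro mult_left_mono) auto
        also have "\<dots> = (w (\<theta> + (e/2) *\<^sub>R v) x + w (\<theta> + (- (e/2)) *\<^sub>R v) x) / (e/2)"
          unfolding w_add by (simp add: distrib_left)
        finally have "w \<theta> x * \<bar>t x \<bullet> v\<bar> \<le> (w (\<theta> + (e/2) *\<^sub>R v) x + w (\<theta> + (- (e/2)) *\<^sub>R v) x) / (e/2)" .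
        moreover have "norm (w \<theta> x * (t x \<bullet> v)) = w \<theta> x * \<bar>t x \<bullet> v\<bar>"
          using w0 by (simp add: abs_mult)
        ultimately show "norm (w \<theta> x * (t x \<bullet> v))
            \<le> norm ((w (\<theta> + (e/2) *\<^sub>R v) x + w (\<theta> + (- (e/2)) *\<^sub>R v) x) / (e/2))"
          unfolding real_norm_def by linarith
      qed
    qed measurable
    define J where "J = (LINT x|\<mu>. w \<theta> x * (t x \<bullet> v))"
    have le: "exp (F \<theta>) + s * J \<le> exp (F (\<theta> + s *\<^sub>R v))" if "\<bar>s\<bar> < e" for s
    proof -
      have "exp (F \<theta>) + s * J = (LINT x|\<mu>. w \<theta> x + s * (w \<theta> x * (t x \<bullet> v)))"
        using int w_int[OF \<theta>E] by (simp add: J_def)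
      also have "\<dots> \<le> (LINT x|\<mu>. w (\<theta> + s *\<^sub>R v) x)"
      proof (rule integral_mono)
        show "integrable \<mu> (\<lambda>x. w \<theta> x + s * (w \<theta> x * (t x \<bullet> v)))"
          using int w_int(1)[OF \<theta>E] by simp
        show "integrable \<mu> (w (\<theta> + s *\<^sub>R v))" by (rule w_int(1)[OF near[OF that]])
        fix x
        have "w \<theta> x * (1 + s * (t x \<bullet> v)) \<le> w \<theta> x * exp (s * (t x \<bullet> v))"
          by (intro mult_left_mono exp_ge_add_one_self) (simp add: w_def)
        then show "w \<theta> x + s * (w \<theta> x * (t x \<bullet> v)) \<le> w (\<theta> + s *\<^sub>R v) x"
          unfolding w_add by (simp add: algebra_simps)
      qed
      also have "\<dots> = exp (F (\<theta> + s *\<^sub>R v))" by (rule w_int(2)[OF near[OF that]])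
      finally show ?thesis .
    qed
    have "(F has_derivative (\<lambda>h. h \<bullet> g)) (at (\<theta> + 0 *\<^sub>R v))" using deriv by (simp add: gderiv_def)
    moreover have "((\<lambda>s. \<theta> + s *\<^sub>R v) has_derivative (\<lambda>h. h *\<^sub>R v)) (at 0)"
      by (auto intro!: derivative_eq_intros)
    ultimately have "((\<lambda>s. F (\<theta> + s *\<^sub>R v)) has_derivative (\<lambda>h. (h *\<^sub>R v) \<bullet> g)) (at 0)"
      using has_derivative_compose by blast
    then have DF: "((\<lambda>s. F (\<theta> + s *\<^sub>R v)) has_real_derivative v \<bullet> g) (at 0)"
      by (simp add: has_field_derivative_def mult.commute[of "v \<bullet> g"] mult_commute_abs)
    have "((\<lambda>s. exp (F (\<theta> + s *\<^sub>R v)) - s * J) has_real_derivative exp (F \<theta>) * (v \<bullet> g) - J) (at 0)"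
      by (auto intro!: derivative_eq_intros DF)
    from DERIV_local_min[OF this e] have "exp (F \<theta>) * (v \<bullet> g) - J = 0"
      using le by (simp add: algebra_simps)
    then show "(LINT x|\<mu>. w \<theta> x * (t x \<bullet> v)) = exp (F \<theta>) * (v \<bullet> g)" by (simp add: J_def)
  qed
  have dens: "exp_density \<mu> t k \<theta> x = w \<theta> x / exp (F \<theta>)" for x
    using finite[OF \<theta>E] by (simp add: exp_density_def w_def exp_diff exp_add field_simps)
  \<comment> \<open>The integrals along the basis vectors are reassembled into the vector-valued
    integral.\<close>
  have dir': "has_bochner_integral \<mu> (\<lambda>x. (exp_density \<mu> t k \<theta> x * (t x \<bullet> b)) *\<^sub>R b) ((b \<bullet> g) *\<^sub>R b)" for b
  proof (rule has_bochner_integral_scaleR_left)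
    show "has_bochner_integral \<mu> (\<lambda>x. exp_density \<mu> t k \<theta> x * (t x \<bullet> b)) (b \<bullet> g)"
      using dir[of b] by (simp add: has_bochner_integral_iff dens field_simps)
  qed
  have "has_bochner_integral \<mu> (\<lambda>x. \<Sum>b\<in>Basis. (exp_density \<mu> t k \<theta> x * (t x \<bullet> b)) *\<^sub>R b)
      (\<Sum>b\<in>Basis. (b \<bullet> g) *\<^sub>R b)"
    by (intro has_bochner_integral_sum dir')
  moreover have "(\<Sum>b\<in>Basis. (exp_density \<mu> t k \<theta> x * (t x \<bullet> b)) *\<^sub>R b) = exp_density \<mu> t k \<theta> x *\<^sub>R t x" for x
    by (simp add: scaleR_scaleR[symmetric] scaleR_sum_right[symmetric] euclidean_representation del: scaleR_scaleR)
  moreover have "(\<Sum>b\<in>Basis. (b \<bullet> g) *\<^sub>R b) = g"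
    by (simp add: inner_commute[of _ g] euclidean_representation)
  ultimately have main: "has_bochner_integral \<mu> (\<lambda>x. exp_density \<mu> t k \<theta> x *\<^sub>R t x) g" by simp
  have [measurable]: "exp_density \<mu> t k \<theta> \<in> borel_measurable \<mu>" unfolding dens[abs_def] by measurable
  have pos: "AE x in \<mu>. 0 \<le> exp_density \<mu> t k \<theta> x" by (simp add: exp_density_def)
  show "integrable (density \<mu> (\<lambda>x. ennreal (exp_density \<mu> t k \<theta> x))) t"
    using main pos by (simp add: integrable_density has_bochner_integral_iff)
  show "exp_expectation \<mu> t k \<theta> t = g"
    using main pos by (simp add: exp_expectation_def integral_density has_bochner_integral_iff)
qed

section \<open>Convergence of the em-algorithm\<close>

context o_minimal_structure
begin

lemma definable_interior:
  assumes "definable A" shows "definable (interior A)"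
proof -
  have "definable {x. \<exists>e. 0 < e \<and> (\<forall>y. norm (x - y) < e \<longrightarrow> y \<in> A)}"
    by (intro definable_intros definable_vimage[OF assms])
  moreover have "interior A = {x. \<exists>e. 0 < e \<and> (\<forall>y. norm (x - y) < e \<longrightarrow> y \<in> A)}"
    by (auto simp: mem_interior subset_iff dist_norm)
  ultimately show ?thesis by simp
qed

lemma definable_funD:
  assumes "definable_fun S f"
  shows "definable {x. \<exists>r. f x = ereal r}" and "definable_map (\<lambda>x. real_of_ereal (f x))"
proof -
  let ?A = "{(x, r). f x = ereal r}"
  have A: "definable ?A" using assms by (simp add: definable_fun_def)
  have "definable {x. \<exists>r. (x, r) \<in> ?A}" by (intro definable_intros definable_vimage[OF A])
  then show "definable {x. \<exists>r. f x = ereal r}" by simp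
  \<comment> \<open>The value 0 matches \<open>real_of_ereal\<close> at the infinite values.\<close>
  have "definable {p. p \<in> ?A \<or> \<not> (\<exists>r. (fst p, r) \<in> ?A) \<and> snd p = 0}"
    by (intro definable_intros definable_vimage[OF A])
  moreover have "(p \<in> ?A \<or> \<not> (\<exists>r. (fst p, r) \<in> ?A) \<and> snd p = 0)
      \<longleftrightarrow> snd p = real_of_ereal (f (fst p))" for p
    by (cases p; cases "f (fst p)") auto
  ultimately show "definable_map (\<lambda>x. real_of_ereal (f x))" by (simp add: definable_map_def)
qed

end

context data_slice
begin

text \<open>The pairs of a model point and the data point projected from it form a proximal sequence
  for \<open>F\<close>, observed through \<open>\<pi> = snd\<close>.\<close>

lemma em_iteration_convergent:
  assumes S: "o_minimal_structure S" and f: "definable_fun S f" and M: "definable_set S M"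
    and M': "compact M" "M \<subseteq> G"
    and q: "\<And>j. q j \<in> DD" and x: "\<And>j. x j \<in> M"
    and m_step: "\<And>j p. p \<in> M \<Longrightarrow> D (x j) (q j) \<le> D p (q j)"
    and e_step: "\<And>j p. p \<in> DD \<Longrightarrow> D (x j) (q (Suc j)) \<le> D (x j) p"
  shows "convergent q"
proof -
  interpret o_minimal_structure S by (rule S)
  have xG: "x j \<in> G" for j using x M' by blast
  have qx: "snd (x j) = snd (q (Suc j))" for j
    using snd_projection[OF xG q e_step] by simp
  define F where "F z = \<phi> (fst z) - \<phi> (snd z)" for z :: "('a \<times> 'b) \<times> ('a \<times> 'b)"
  \<comment> \<open>\<open>x j\<close> is paired with \<open>q (Suc j)\<close>, which the e-step
    produces from it, so that both share the hidden component.\<close>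
  define z where "z j = (x j, q (Suc j))" for j
  define Z' where "Z' = Z M (F (z 0))"
  have Fz: "F (z j) = D (x j) (q (Suc j))" for j
    using D_eq_\<phi>_diff[OF q qx] by (simp add: F_def z_def)
  have split: "D p (q j) = F (p, y) + D y (q j)" if "y \<in> DD" "snd p = snd y" for p y j
    using pythagoras[OF that(1) q that(2)] by (simp add: F_def)
  \<comment> \<open>The m-step combined with Pythagoras. Taking \<open>p = x j\<close> gives the
    descent, and taking \<open>p\<close> from an arbitrary pair of \<open>Z'\<close> gives the
    proximal inequality.\<close>
  have step: "F (z (Suc j)) + D (q (Suc (Suc j))) (q (Suc j)) \<le> D p (q (Suc j))" if "p \<in> M" for p j
    using m_step[OF that, of "Suc j"] split[OF q qx, of "Suc j" "Suc j"] by (simp add: z_def)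
  have "F (z (Suc j)) \<le> F (z j)" for j
    using step[OF x, of j j] D_nonneg[OF DD_G[OF q] DD_G[OF q]] Fz[of j] by (smt (verit))
  then have "F (z j) \<le> F (z 0)" for j by (induction j) (auto intro: order_trans)
  then have zZ: "z j \<in> Z'" for j
    using x q qx by (simp add: Z'_def Z_def F_def z_def)
  have cZ: "compact Z'"
    unfolding Z'_def compact_eq_bounded_closed
    using bounded_Z[OF M' q] closed_Z[OF M'] by blast
  have ZG: "fst u \<in> G" "snd u \<in> G" if "u \<in> Z'" for u
    using that M' DD_G by (auto simp: Z'_def Z_def)
  \<comment> \<open>The quadratic and Lipschitz bounds require a convex set; the hull stays inside
    \<open>G\<close> because \<open>G\<close> is convex.\<close>
  define K where "K = convex hull (snd ` Z')"
  have K: "compact K" "convex K" "K \<subseteq> G"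
    unfolding K_def
    by (intro compact_convex_hull compact_continuous_image continuous_intros cZ)
      (simp, intro hull_minimal convex_G image_subsetI ZG)
  have KZ: "snd u \<in> K" if "u \<in> Z'" for u using that hull_subset unfolding K_def by fast
  have qK: "q (Suc j) \<in> K" for j using KZ[OF zZ[of j]] by (simp add: z_def)
  obtain c where c: "0 < c" "\<And>x y. x \<in> K \<Longrightarrow> y \<in> K \<Longrightarrow> c * (norm (x - y))\<^sup>2 \<le> D x y"
    using D_lower_bound[OF K] by metis
  obtain C where C: "0 \<le> C"
    "\<And>x y. x \<in> K \<Longrightarrow> y \<in> K \<Longrightarrow> norm (grad f x - grad f y) \<le> C * norm (x - y)"
    using grad_lipschitz[OF K] by metis
  have "{x. \<exists>r. f x = ereal r} = edom f" using edom_iff by blast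
  then have dG: "definable G" using definable_interior definable_funD(1)[OF f] by (simp add: G_def)
  have dfr: "definable_map fr" using definable_funD(2)[OF f] by (simp add: fr_def[abs_def])
  have d\<phi>: "definable_map \<phi>"
    unfolding \<phi>_def[abs_def] by (intro definable_intros definable_map_comp[OF _ dfr])
  have "definable {y. y \<in> G \<and> (\<forall>u. (u, snd y) \<in> G \<longrightarrow> \<phi> y \<le> \<phi> (u, snd y))}"
    by (intro definable_intros definable_vimage[OF dG] definable_map_comp[OF _ d\<phi>])
  then have dDD: "definable DD" by (simp add: DD_iff_slice_minimizer[symmetric])
  have dF: "definable_map F"
    unfolding F_def[abs_def] by (intro definable_intros definable_map_comp[OF _ d\<phi>])
  have dZ: "definable Z'"
    unfolding Z'_def Z_def
    by (intro definable_intros definable_vimage[OF M] definable_vimage[OF dDD] definable_map_comp[OF _ d\<phi>])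
  have "convergent (\<lambda>j. snd (z j))"
  proof (rule definable_proximal_sequence_convergent[OF cZ dZ _ dF _ _ zZ c(1) C(1)])
    show "continuous_on Z' F"
      unfolding F_def using ZG
      by (intro continuous_intros continuous_on_compose2[OF continuous_on_\<phi>]) auto
    show "continuous_on Z' snd" by (intro continuous_intros)
    show "definable_map (snd :: ('a \<times> 'b) \<times> ('a \<times> 'b) \<Rightarrow> _)"
      by (intro definable_intros)
    fix j
    show "F (z (Suc j)) + c * (norm (snd (z (Suc j)) - snd (z j)))\<^sup>2 \<le> F (z j)"
      using step[OF x, of j j] c(2)[OF qK[of "Suc j"] qK[of j]] Fz[of j] by (simp add: z_def)
    fix u assume u: "u \<in> Z'"
    define y where "y = snd u"
    have uu: "fst u \<in> M" "y \<in> DD" "snd (fst u) = snd y" using u by (auto simp: Z'_def Z_def y_def)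
    have yK: "y \<in> K" using KZ[OF u] by (simp add: y_def)
    let ?q = "q (Suc (Suc j))" and ?p = "q (Suc j)"
    \<comment> \<open>Pythagoras for the competing pair turns \<open>step\<close> into a difference
      of distances to the old data point, which the three-point identity re-centres at the new
      one.\<close>
    have "F (z (Suc j)) - F u \<le> D y ?p - D ?q ?p"
      using step[OF uu(1), of j] split[OF uu(2,3), of "Suc j"] by (simp add: y_def)
    also have "\<dots> = D y ?q + (grad f ?q - grad f ?p) \<bullet> (y - ?q)"
      using three_points[of y ?p ?q] by simp
    also have "\<dots> \<le> C * (norm (y - ?q))\<^sup>2 + C * norm (?q - ?p) * norm (y - ?q)"
    proof (rule add_mono)
      show "D y ?q \<le> C * (norm (y - ?q))\<^sup>2"
        by (rule D_upper_bound) (use K yK qK C(2) in auto)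
      have "(grad f ?q - grad f ?p) \<bullet> (y - ?q) \<le> norm (grad f ?q - grad f ?p) * norm (y - ?q)"
        by (rule norm_cauchy_schwarz)
      also have "\<dots> \<le> C * norm (?q - ?p) * norm (y - ?q)"
        by (intro mult_right_mono C(2) qK) simp
      finally show "(grad f ?q - grad f ?p) \<bullet> (y - ?q) \<le> C * norm (?q - ?p) * norm (y - ?q)" .
    qed
    finally show "F (z (Suc j)) - F u \<le> C * norm (snd (z (Suc j)) - snd (z j)) * norm (snd u - snd (z (Suc j)))
        + C * (norm (snd u - snd (z (Suc j))))\<^sup>2"
      by (simp add: z_def y_def)
  qed
  then have "convergent (\<lambda>j. q (Suc j))" by (simp add: z_def)
  then show ?thesis using convergent_Suc_iff by blast
qed

end

theorem theorem11p5:
  fixes \<mu> :: "'x measure"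
    and t1 :: "'x \<Rightarrow> real ^ 'p"
    and t2 :: "'x \<Rightarrow> real ^ 'q"
    and t :: "'x \<Rightarrow> (real ^ 'p) \<times> (real ^ 'q)"
    and k :: "'x \<Rightarrow> real"
    and f :: "(real ^ 'p) \<times> (real ^ 'q) \<Rightarrow> ereal"
    and G M D :: "((real ^ 'p) \<times> (real ^ 'q)) set"
    and y_hat :: "real ^ 'p"
    and S :: "nat \<Rightarrow> real list set set"
    and \<theta>' \<theta> :: "nat \<Rightarrow> (real ^ 'p) \<times> (real ^ 'q)"
  assumes "t1 \<in> borel_measurable \<mu>" and "t2 \<in> borel_measurable \<mu>"
    and "k \<in> borel_measurable \<mu>"
    and t_def: "t = (\<lambda>x. (t1 x, t2 x))"
    and f_def: "f = log_normalizer \<mu> t k"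
    and G_def: "G = interior (edom f)"
    and steep: "legendre_type f"
    and smooth: "C2_pos_def_on f G"
    and "o_minimal_structure S"
    and "definable_fun S f" and "definable_set S M"
    and "M \<noteq> {}" and "M \<subseteq> G" and "closed M" and "bounded M"
    and D_def: "D = {\<theta> \<in> G. exp_expectation \<mu> t k \<theta> t1 = y_hat}" and "D \<noteq> {}"
    and "\<And>j. \<theta>' j \<in> D"
    and "\<And>j. \<theta> j \<in> left_proj f M (\<theta>' j)"
    and "\<And>j. \<theta>' (Suc j) \<in> right_proj f D (\<theta> j)"
  shows "convergent \<theta>'"
proof -
  interpret L: data_slice f y_hat
    using steep smooth unfolding G_def by unfold_locales
  have G: "L.G = G" by (simp add: L.G_def G_def)
  \<comment> \<open>The mean of \<open>t1\<close> is the first component of that of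
    \<open>t\<close>; integrability of \<open>t\<close> lets the projection leave the
    integral.\<close>
  have "exp_expectation \<mu> t k \<theta> t1 = fst (grad f \<theta>)" if \<theta>: "\<theta> \<in> G" for \<theta>
  proof -
    have t_meas: "t \<in> borel_measurable \<mu>"
      unfolding t_def using assms(1,2) by (rule borel_measurable_Pair)
    have int: "integrable (density \<mu> (\<lambda>x. ennreal (exp_density \<mu> t k \<theta> x))) t"
      and grad: "exp_expectation \<mu> t k \<theta> t = grad f \<theta>"
      using exp_expectation_eq_grad[OF t_meas assms(3), of L.fr \<theta> "grad f \<theta>"] \<theta> L.ereal_fr L.GDERIV_fr
      unfolding f_def[symmetric] G_def[symmetric] G by auto
    have "t1 = (\<lambda>x. fst (t x))" by (simp add: t_def)
    then have "exp_expectation \<mu> t k \<theta> t1 = fst (exp_expectation \<mu> t k \<theta> t)"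
      unfolding exp_expectation_def using integral_bounded_linear[OF bounded_linear_fst int] by simp
    then show ?thesis by (simp add: grad)
  qed
  then have D: "D = L.DD" unfolding D_def L.DD_def G by auto
  have M: "compact M" "M \<subseteq> L.G"
    using \<open>closed M\<close> \<open>bounded M\<close> \<open>M \<subseteq> G\<close> by (simp_all add: G compact_eq_bounded_closed)
  have \<theta>M: "\<theta> j \<in> M" for j
    using \<open>\<theta> j \<in> left_proj f M (\<theta>' j)\<close> by (simp add: left_proj_def is_arg_min_def)
  have \<theta>'D: "\<theta>' j \<in> L.DD" for j using \<open>\<theta>' j \<in> D\<close> by (simp add: D)
  note \<theta>G = subsetD[OF M(2) \<theta>M] and \<theta>'G = L.DD_G[OF \<theta>'D]
  show ?thesis
  proof (rule L.em_iteration_convergent[OF \<open>o_minimal_structure S\<close> \<open>definable_fun S f\<close>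
        \<open>definable_set S M\<close> M \<theta>'D \<theta>M])
    fix j p
    show "L.D (\<theta> j) (\<theta>' j) \<le> L.D p (\<theta>' j)" if p: "p \<in> M"
    proof -
      \<comment> \<open>\<open>is_arg_min\<close> excludes strictly smaller values; all points
        involved lie in \<open>G\<close>, where the extended-real distance equals the real
        one.\<close>
      have "\<not> bregman f p (\<theta>' j) < bregman f (\<theta> j) (\<theta>' j)"
        using \<open>\<theta> j \<in> left_proj f M (\<theta>' j)\<close> p unfolding left_proj_def is_arg_min_def by blast
      then show ?thesis
        by (simp add: L.bregman_eq[OF subsetD[OF M(2) p] \<theta>'G] L.bregman_eq[OF \<theta>G \<theta>'G])
    qed
    show "L.D (\<theta> j) (\<theta>' (Suc j)) \<le> L.D (\<theta> j) p" if p: "p \<in> L.DD"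
    proof -
      have "\<not> bregman f (\<theta> j) p < bregman f (\<theta> j) (\<theta>' (Suc j))"
        using \<open>\<theta>' (Suc j) \<in> right_proj f D (\<theta> j)\<close> p
        unfolding right_proj_def is_arg_min_def D by blast
      then show ?thesis
        by (simp add: L.bregman_eq[OF \<theta>G L.DD_G[OF p]] L.bregman_eq[OF \<theta>G \<theta>'G])
    qed
  qed
qed

end
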